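(* Let $\lambda$ be a partition. For each reverse plane partition $\pi$ of shape $\lambda$ there exists a unique sequence of rim-hooks $h_1\leq\dots\leq h_s$ of $\lambda$ (with respect to the rim-hook order) such that $h_i$ inserts into $h_{i+1}*\cdots*h_s*0$ for all $i\in\{1,\dots,s\}$, and \[\pi=h_1*\cdots*h_s*0,\] where $0$ is the zero reverse plane partition of shape $\lambda$. The correspondence $\pi\mapsto(h_1,\dots,h_s)$ gives a bijection between reverse plane partitions of shape $\lambda$ and finite multi-sets of rim-hooks of $\lambda$.
   Context: Cells are pairs $(i,j)\in\mathbb Z^2$; for $u=(i,j)$ write $\mathrm n u=(i-1,j)$, $\mathrm e u=(i,j+1)$, $\mathrm s u=(i+1,j)$, $\mathrm w u=(i,j-1)$ (composites such as $\mathrm e\mathrm s u$ are applied successively). A partition $\lambda=(\lambda_1\ge\dots\ge\lambda_r>0)$ is identified with its Young diagram $\{(i,j):1\le i\le r,\ 1\le j\le\lambda_i\}$; $\lambda'$ is the conjugate partition. A reverse plane partition of shape $\lambda$ is a map $\pi:\lambda\to\mathbb N=\{0,1,2,\dots\}$ with $\pi(u)\le\pi(\mathrm e u)$ and $\pi(u)\le\pi(\mathrm s u)$ for all $u\in\lambda$, using the conventions $\pi(i,j)=0$ if $i\le0$ or $j\le0$, and $\pi(i,j)=\infty$ if $i,j\ge1$ and $(i,j)\notin\lambda$. The zero reverse plane partition has all entries $0$. Content: $c(i,j)=j-i$. A cell $u\in\lambda$ is an outer corner if $\mathrm e u,\mathrm s u\notin\lambda$, an inner corner if $\mathrm e u,\mathrm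 s u\in\lambda$ but $\mathrm e\mathrm s u\notin\lambda$. Let $i_1<\dots<i_r$ be the contents of the inner corners and $o_1<\dots<o_{r+1}$ those of the outer corners, so $o_1<i_1<o_2<\dots<o_r<i_r<o_{r+1}$. Put $\mathcal I=\{u\in\lambda:c(u)=i_k\text{ for some }k\}$, $\mathcal O=\{u\in\lambda:c(u)=o_k\text{ for some }k\}$, $\mathcal A=\{u\in\lambda:c(u)<o_1\text{ or }i_k<c(u)<o_{k+1}\text{ for some }k\in[r]\}$, $\mathcal B=\{u\in\lambda:o_k<c(u)<i_k\text{ for some }k\in[r]\text{ or }o_{r+1}<c(u)\}$. A north-east path is a sequence $P=(u_0,\dots,u_s)$ of cells of $\lambda$ with $u_k\in\{\mathrm n u_{k-1},\mathrm e u_{k-1}\}$; its length is $\ell(P)=s$, head $\alpha(P)=u_0$, tail $\omega(P)=u_s$. A south-west path is $Q=(v_0,\dots,v_s)$ with $v_k\in\{\mathrm s v_{k-1},\mathrm w v_{k-1}\}$; $\ell(Q)=s$, $\alpha(Q)=v_s$, $\omega(Q)=v_0$. A rim-hook of $\lambda$ is a north-east path $h$ in $\lambda$ with $\mathrm s\alpha(h)\notin\lambda$, $\mathrm e\omega(h)\notin\lambda$ and $\mathrm e\mathrm s u\notin\lambda$ for all $u\in h$; for each $u=(i,j)\in\lambda$ there is a unique rim-hook $h^u$ with $\alpha(h^u)=(\lambda'_j,j)$ and $\omega(h^u)=(i,\lambda_i)$, and every rim-hook arises this way. Reverse lexicographic order on cells: $(i,j)\le(k,l)$ iff $j>l$,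 or $j=l$ and $i\ge k$. Rim-hooks are ordered by $h^u\le h^v$ iff $u\le v$. For a path $P$ let $(\pi+P)(u)=\pi(u)+1$ if $u\in P$ and $\pi(u)$ otherwise. $(P,\pi)$ is compatible if (1) $u\in P$, $u\in\mathcal I\cup\mathcal A$ imply $\mathrm e u\in P$ and $\pi(u)=\pi(\mathrm e u)$; and (2) $u,\mathrm s u\in P$ imply $\pi(u)=\pi(\mathrm s u)$. A rim-hook $h$ inserts into $\pi$ if there is a path $P$ with $\omega(P)=\omega(h)$, $\ell(P)=\ell(h)$, $(P,\pi)$ compatible and $\pi+P$ a reverse plane partition. In that case $h*\pi=\pi+P(h,\pi)$, where $P(h,\pi)$ is the south-west path constructed by starting at $\omega(h)$ and, while its length is less than $\ell(h)$, moving from the current cell $u$ to $\mathrm s u$ if $u\in\mathcal B\cup\mathcal I$ and $\pi(u)=\pi(\mathrm s u)$, and to $\mathrm w u$ otherwise. Iterated insertions are read right to left: $h_1*h_2*\cdots*h_s*0=h_1*(h_2*(\cdots(h_s*0)))$. *)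

theory Defs
  imports "HOL-Library.Multiset" "HOL-Library.Extended_Nat"
begin

type_synonym cell = "int \<times> int"

definition nn :: "cell \<Rightarrow> cell" where "nn u = (fst u - 1, snd u)"
definition ee :: "cell \<Rightarrow> cell" where "ee u = (fst u, snd u + 1)"
definition ss :: "cell \<Rightarrow> cell" where "ss u = (fst u + 1, snd u)"
definition ww :: "cell \<Rightarrow> cell" where "ww u = (fst u, snd u - 1)"

definition is_partition :: "nat list \<Rightarrow> bool" where
  "is_partition lam \<longleftrightarrow> sorted_wrt (\<ge>) lam \<and> (\<forall>x\<in>set lam. 0 < x)"

text \<open>The part \<open>\<lambda>\<^sub>i\<close> with its 1-based index (0 outside the index range), and the conjugate part.\<close>

definition part :: "nat list \<Rightarrow> int \<Rightarrow> int" where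
  "part lam i = (if 1 \<le> i \<and> i \<le> int (length lam) then int (lam ! nat (i - 1)) else 0)"

definition conj_part :: "nat list \<Rightarrow> int \<Rightarrow> int" where
  "conj_part lam j = int (card {i. 1 \<le> i \<and> i \<le> int (length lam) \<and> j \<le> part lam i})"

definition diagram :: "nat list \<Rightarrow> cell set" where
  "diagram lam = {(i, j). 1 \<le> i \<and> i \<le> int (length lam) \<and> 1 \<le> j \<and> j \<le> part lam i}"

text \<open>
  A reverse plane partition is represented together with its conventional values outside the
  diagram, as a function on all cells: finite on the diagram, 0 at cells with a nonpositive
  coordinate and \<open>\<infinity>\<close> at the remaining cells. Distinct maps on the diagram correspond to
  distinct functions.
\<close>

definition rpps :: "nat list \<Rightarrow> (cell \<Rightarrow> enat) set" where
  "rpps lam = {p.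
     (\<forall>u\<in>diagram lam. p u \<noteq> \<infinity>) \<and>
     (\<forall>u. u \<notin> diagram lam \<longrightarrow> p u = (if fst u \<le> 0 \<or> snd u \<le> 0 then 0 else \<infinity>)) \<and>
     (\<forall>u\<in>diagram lam. p u \<le> p (ee u) \<and> p u \<le> p (ss u))}"

definition zero_rpp :: "nat list \<Rightarrow> cell \<Rightarrow> enat" where
  "zero_rpp lam u = (if u \<in> diagram lam \<or> fst u \<le> 0 \<or> snd u \<le> 0 then 0 else \<infinity>)"

definition content :: "cell \<Rightarrow> int" where
  "content u = snd u - fst u"

definition outer_corner :: "nat list \<Rightarrow> cell \<Rightarrow> bool" where
  "outer_corner lam u \<longleftrightarrow> u \<in> diagram lam \<and> ee u \<notin> diagram lam \<and> ss u \<notin> diagram lam"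

definition inner_corner :: "nat list \<Rightarrow> cell \<Rightarrow> bool" where
  "inner_corner lam u \<longleftrightarrow> u \<in> diagram lam \<and> ee u \<in> diagram lam \<and> ss u \<in> diagram lam
     \<and> ee (ss u) \<notin> diagram lam"

text \<open>
  The increasing lists \<open>[o\<^sub>1, \<dots>, o\<^sub>r\<^sub>+\<^sub>1]\<close> and \<open>[i\<^sub>1, \<dots>, i\<^sub>r]\<close>; list indices below are
  shifted by one. For the empty partition these lists are empty, but so are the regions defined from them.
\<close>

definition outer_contents :: "nat list \<Rightarrow> int list" where
  "outer_contents lam = sorted_list_of_set (content ` {u. outer_corner lam u})"

definition inner_contents :: "nat list \<Rightarrow> int list" where
  "inner_contents lam = sorted_list_of_set (content ` {u. inner_corner lam u})"

definition region_I :: "nat list \<Rightarrow> cell set" where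
  "region_I lam = {u \<in> diagram lam. content u \<in> set (inner_contents lam)}"

definition region_A :: "nat list \<Rightarrow> cell set" where
  "region_A lam = {u \<in> diagram lam.
     content u < outer_contents lam ! 0 \<or>
     (\<exists>k < length (inner_contents lam).
        inner_contents lam ! k < content u \<and> content u < outer_contents lam ! Suc k)}"

definition region_B :: "nat list \<Rightarrow> cell set" where
  "region_B lam = {u \<in> diagram lam.
     (\<exists>k < length (inner_contents lam).
        outer_contents lam ! k < content u \<and> content u < inner_contents lam ! k) \<or>
     outer_contents lam ! length (inner_contents lam) < content u}"

text \<open>
  Paths are nonempty lists of cells; a path with \<open>n + 1\<close> cells has length \<open>n\<close>. Head and tail of
  a north-east path are the first and the last cell of the list. The reverse of a south-west path
  is a north-east path with the same cells, length, head and tail.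
\<close>

definition ne_path :: "nat list \<Rightarrow> cell list \<Rightarrow> bool" where
  "ne_path lam P \<longleftrightarrow> P \<noteq> [] \<and> set P \<subseteq> diagram lam \<and>
     (\<forall>k. Suc k < length P \<longrightarrow> P ! Suc k = nn (P ! k) \<or> P ! Suc k = ee (P ! k))"

definition path_length :: "cell list \<Rightarrow> nat" where
  "path_length P = length P - 1"

definition rim_hook :: "nat list \<Rightarrow> cell list \<Rightarrow> bool" where
  "rim_hook lam h \<longleftrightarrow> ne_path lam h \<and> ss (hd h) \<notin> diagram lam \<and> ee (last h) \<notin> diagram lam \<and>
     (\<forall>u\<in>set h. ee (ss u) \<notin> diagram lam)"

text \<open>\<open>hook_at lam u h\<close> says that \<open>h\<close> is the rim-hook \<open>h\<^sup>u\<close> of the cell \<open>u\<close> of the diagram.\<close>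

definition hook_at :: "nat list \<Rightarrow> cell \<Rightarrow> cell list \<Rightarrow> bool" where
  "hook_at lam u h \<longleftrightarrow> u \<in> diagram lam \<and> rim_hook lam h \<and>
     hd h = (conj_part lam (snd u), snd u) \<and> last h = (fst u, part lam (fst u))"

definition cell_le :: "cell \<Rightarrow> cell \<Rightarrow> bool" where
  "cell_le u v \<longleftrightarrow> snd u > snd v \<or> (snd u = snd v \<and> fst u \<ge> fst v)"

definition hook_le :: "nat list \<Rightarrow> cell list \<Rightarrow> cell list \<Rightarrow> bool" where
  "hook_le lam g h \<longleftrightarrow> (\<exists>u v. hook_at lam u g \<and> hook_at lam v h \<and> cell_le u v)"

definition add_path :: "(cell \<Rightarrow> enat) \<Rightarrow> cell list \<Rightarrow> cell \<Rightarrow> enat" where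
  "add_path p P u = (if u \<in> set P then p u + 1 else p u)"

definition compatible :: "nat list \<Rightarrow> cell list \<Rightarrow> (cell \<Rightarrow> enat) \<Rightarrow> bool" where
  "compatible lam P p \<longleftrightarrow>
     (\<forall>u\<in>set P. u \<in> region_I lam \<union> region_A lam \<longrightarrow> ee u \<in> set P \<and> p u = p (ee u)) \<and>
     (\<forall>u\<in>set P. ss u \<in> set P \<longrightarrow> p u = p (ss u))"

definition inserts :: "nat list \<Rightarrow> cell list \<Rightarrow> (cell \<Rightarrow> enat) \<Rightarrow> bool" where
  "inserts lam h p \<longleftrightarrow> (\<exists>P. ne_path lam P \<and> last P = last h \<and> path_length P = path_length h \<and>
     compatible lam P p \<and> add_path p P \<in> rpps lam)"

text \<open>The south-west path with \<open>n\<close> steps starting at \<open>u\<close>, listed from \<open>u\<close> on.\<close>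

fun sw_walk :: "nat list \<Rightarrow> (cell \<Rightarrow> enat) \<Rightarrow> nat \<Rightarrow> cell \<Rightarrow> cell list" where
  "sw_walk lam p 0 u = [u]"
| "sw_walk lam p (Suc n) u =
     u # sw_walk lam p n (if u \<in> region_B lam \<union> region_I lam \<and> p u = p (ss u) then ss u else ww u)"

definition insertion_path :: "nat list \<Rightarrow> cell list \<Rightarrow> (cell \<Rightarrow> enat) \<Rightarrow> cell list" where
  "insertion_path lam h p = sw_walk lam p (path_length h) (last h)"

text \<open>Only meaningful if \<open>h\<close> inserts into \<open>p\<close>.\<close>

definition hook_insert :: "nat list \<Rightarrow> cell list \<Rightarrow> (cell \<Rightarrow> enat) \<Rightarrow> cell \<Rightarrow> enat" where
  "hook_insert lam h p = add_path p (insertion_path lam h p)"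

definition insert_all :: "nat list \<Rightarrow> cell list list \<Rightarrow> cell \<Rightarrow> enat" where
  "insert_all lam hs = foldr (hook_insert lam) hs (zero_rpp lam)"

definition hook_factorization :: "nat list \<Rightarrow> (cell \<Rightarrow> enat) \<Rightarrow> cell list list \<Rightarrow> bool" where
  "hook_factorization lam p hs \<longleftrightarrow>
     (\<forall>h\<in>set hs. rim_hook lam h) \<and>
     sorted_wrt (hook_le lam) hs \<and>
     (\<forall>k < length hs. inserts lam (hs ! k) (insert_all lam (drop (Suc k) hs))) \<and>
     p = insert_all lam hs"

end

theory Submission
  imports Defs
begin

text \<open>
  Give the cell in row \<open>r\<close> of content \<open>c\<close> the coordinates \<open>(r, c)\<close>, so that a path meets each
  content of an interval once. Build the shape column by column. A reverse plane partition \<open>p\<close> of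
  the first \<open>b + 1\<close> columns corresponds to one of the first \<open>b\<close> columns, \<open>s\<close>, together
  with multiplicities \<open>m\<close> for the cells of column \<open>b + 1\<close>, through the local rule of the
  Robinson-Schensted-Knuth correspondence
  \[ p(r,c) + s(r,c) = \max (p(r-1,c+1), s(r,c-1)) + \min (p(r,c+1), s(r+1,c-1)), \]
  which is invertible in either direction. Iterating, reverse plane partitions correspond
  bijectively to fillings of the shape with multiplicities.

  If no cell of column \<open>b + 1\<close> or later has been used, \<open>p\<close> is \<open>s\<close> with one diagonal repeated,
  and insertion paths only acquire one more east step. If the hooks of the last column are inserted
  from top to bottom, insertion is Schensted row insertion of a weakly increasing word, and
  increases one multiplicity in the local rule by one. Hence every sorted sequence of rim-hooks can
  be inserted and its filling is the multiplicity function of the sequence.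
\<close>

section \<open>Adding a column\<close>

locale heights =
  fixes h :: "int \<Rightarrow> int"
  assumes h_anti: "1 \<le> j \<Longrightarrow> j \<le> k \<Longrightarrow> h k \<le> h j"
begin

definition inD :: "nat \<Rightarrow> int \<Rightarrow> int \<Rightarrow> bool" where
  "inD b r c \<longleftrightarrow> 1 \<le> r \<and> 1 \<le> r + c \<and> r + c \<le> int b \<and> r \<le> h (r + c)"

text \<open>
  \<open>estep b c\<close> says that the south-east boundary of the shape, followed from south-west to
  north-east, enters its vertex of content \<open>c\<close> by an east step: the bottom edge of column \<open>j\<close>
  with \<open>c = j - h j\<close>. On the cells of content \<open>c\<close>, membership in the regions depends only on the
  steps into and out of this vertex.
\<close>

definition estep :: "nat \<Rightarrow> int \<Rightarrow> bool" where
  "estep b c \<longleftrightarrow> (\<exists>j. 1 \<le> j \<and> j \<le> int b \<and> c = j - h j)"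

text \<open>In these coordinates \<open>f r (c - 1)\<close> is the western and
  \<open>f (r - 1) (c + 1)\<close> the northern neighbour. Comparing only with these two lets the
  value 0 outside the shape serve as the boundary convention, so all values are integers.\<close>

definition rpp :: "nat \<Rightarrow> (int \<Rightarrow> int \<Rightarrow> int) \<Rightarrow> bool" where
  "rpp b f \<longleftrightarrow> (\<forall>r c. \<not> inD b r c \<longrightarrow> f r c = 0) \<and>
     (\<forall>r c. inD b r c \<longrightarrow> 0 \<le> f r c \<and> f r (c - 1) \<le> f r c \<and> f (r - 1) (c + 1) \<le> f r c)"

text \<open>The content of the bottom cell of column \<open>b + 1\<close>.\<close>

definition corner :: "nat \<Rightarrow> int" where
  "corner b = int b + 1 - h (int b + 1)"

text \<open>Apart from \<open>p r c\<close> and \<open>s r c\<close>, the rule at content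
  \<open>c\<close> involves \<open>p\<close> only at content \<open>c + 1\<close> and
  \<open>s\<close> only at content \<open>c - 1\<close>. Hence \<open>p\<close> is computed from
  \<open>s\<close> by decreasing content, and \<open>s\<close> from \<open>p\<close> by increasing
  content. In the last column \<open>s r c\<close> is 0 and \<open>m r\<close> takes the place of
  the minimum.\<close>

definition column_step ::
  "nat \<Rightarrow> (int \<Rightarrow> int \<Rightarrow> int) \<Rightarrow> (int \<Rightarrow> nat) \<Rightarrow> (int \<Rightarrow> int \<Rightarrow> int) \<Rightarrow> bool" where
  "column_step b s m p \<longleftrightarrow> rpp b s \<and>
     (\<forall>r c. \<not> inD (Suc b) r c \<longrightarrow> p r c = 0) \<and>
     (\<forall>r c. c < corner b \<longrightarrow> p r c = s r c) \<and>
     (\<forall>r c. inD b r c \<longrightarrow> corner b \<le> c \<longrightarrow>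
        p r c + s r c = max (p (r - 1) (c + 1)) (s r (c - 1)) + min (p r (c + 1)) (s (r + 1) (c - 1))) \<and>
     (\<forall>r c. inD (Suc b) r c \<longrightarrow> r + c = int b + 1 \<longrightarrow>
        p r c = max (p (r - 1) (c + 1)) (s r (c - 1)) + int (m r))"

lemma inD_Suc: "inD (Suc b) r c \<longleftrightarrow> inD b r c \<or> (1 \<le> r \<and> r + c = int b + 1 \<and> r \<le> h (int b + 1))"
  unfolding inD_def by (smt (verit, ccfv_threshold) of_nat_Suc of_nat_0_le_iff)

lemma inD_left: "inD b r c \<Longrightarrow> 1 \<le> r + (c - 1) \<Longrightarrow> inD b r (c - 1)"
  unfolding inD_def using h_anti[of "r + (c - 1)" "r + c"] by auto

lemma inD_up: "inD b r c \<Longrightarrow> 1 \<le> r - 1 \<Longrightarrow> inD b (r - 1) (c + 1)"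
  unfolding inD_def by (auto simp: algebra_simps)

text \<open>An old cell of content at least \<open>corner b\<close> lies in a row strictly above the
  bottom of column \<open>b + 1\<close>, the shortest column. So both entries of the minimum in the
  local rule sit at cells of the shape, and the value 0 outside never enters a minimum.\<close>

lemma inD_low:
  assumes "inD b r c" "corner b \<le> c"
  shows "inD b (r + 1) (c - 1)" "inD (Suc b) r (c + 1)"
proof -
  have "h (int b + 1) \<le> h (r + c)" "h (int b + 1) \<le> h (r + c + 1)"
    using assms h_anti unfolding inD_def by (auto intro!: h_anti)
  then show "inD b (r + 1) (c - 1)" "inD (Suc b) r (c + 1)"
    using assms unfolding inD_def corner_def by (auto simp: algebra_simps)
qed

lemma last_column_corner: "inD (Suc b) r c \<Longrightarrow> r + c = int b + 1 \<Longrightarrow> corner b \<le> c"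
  unfolding inD_def corner_def by auto

lemma not_inD_above: "c \<ge> int b \<Longrightarrow> \<not> inD b r c"
  unfolding inD_def by auto

text \<open>By induction on decreasing content, \<open>s r c\<close> lies between the maximum and
  the minimum of the local rule. The rule reflects this interval, so \<open>p r c\<close> lies in it
  too. The induction starts at contents that no cell has.\<close>

lemma column_step_bounds:
  assumes cs: "column_step b s m p" and c: "corner b \<le> c"
  shows "(\<forall>r. inD (Suc b) r c \<longrightarrow> p (r - 1) (c + 1) \<le> p r c \<and> s r (c - 1) \<le> p r c \<and> 0 \<le> p r c) \<and>
         (\<forall>r. inD b r c \<longrightarrow> p r c \<le> p r (c + 1) \<and> p r c \<le> s (r + 1) (c - 1))"
    (is "?A c \<and> ?B c")
  using c
proof (induction "nat (int b + 1 - c)" arbitrary: c)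
  case 0
  then show ?case using not_inD_above[of "Suc b" c] not_inD_above[of b c] by auto
next
  case (Suc n)
  have IH: "?A (c + 1) \<and> ?B (c + 1)"
    by (rule Suc.hyps(1)) (use Suc.hyps(2) Suc.prems in auto)
  have rs: "\<And>r c. \<not> inD b r c \<Longrightarrow> s r c = 0"
     "\<And>r c. inD b r c \<Longrightarrow> 0 \<le> s r c \<and> s r (c - 1) \<le> s r c \<and> s (r - 1) (c + 1) \<le> s r c"
     and pz: "\<And>r c. \<not> inD (Suc b) r c \<Longrightarrow> p r c = 0"
    using cs unfolding column_step_def rpp_def by blast+
  have s0: "0 \<le> s r c" for r c using rs by (cases "inD b r c") auto
  have p0: "0 \<le> p r (c + 1)" for r using IH pz by (cases "inD (Suc b) r (c + 1)") auto
  have *: "p (r - 1) (c + 1) \<le> p r c \<and> s r (c - 1) \<le> p r c \<and> p r c \<le> p r (c + 1) \<and> p r c \<le> s (r + 1) (c - 1)"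
    if r: "inD b r c" for r
  proof -
    have eq: "p r c + s r c = max (p (r - 1) (c + 1)) (s r (c - 1)) + min (p r (c + 1)) (s (r + 1) (c - 1))"
      using cs r Suc.prems unfolding column_step_def by blast
    note l = inD_low[OF r Suc.prems]
    have 1: "s r c \<le> p r (c + 1)" using IH l by force
    have 2: "s r (c - 1) \<le> s r c" using rs r by blast
    have 3: "s r c \<le> s (r + 1) (c - 1)" using rs(2)[OF l(1)] by simp
    have 4: "p (r - 1) (c + 1) \<le> s r c"
    proof (cases "1 \<le> r - 1")
      case True then show ?thesis using IH inD_up[OF r] by force
    next
      case False
      then have "\<not> inD (Suc b) (r - 1) (c + 1)" unfolding inD_def by auto
      then show ?thesis using pz s0 by auto
    qed
    show ?thesis using eq 1 2 3 4 by linarith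
  qed
  have **: "p (r - 1) (c + 1) \<le> p r c \<and> s r (c - 1) \<le> p r c"
    if r: "inD (Suc b) r c" for r
  proof (cases "inD b r c")
    case False
    then have "r + c = int b + 1" using r inD_Suc by blast
    then have "p r c = max (p (r - 1) (c + 1)) (s r (c - 1)) + int (m r)"
      using cs r unfolding column_step_def by blast
    then show ?thesis by linarith
  qed (use * in blast)
  show ?case using * ** s0 by (smt (verit))
qed

text \<open>Below content \<open>corner b\<close> the entries are those of \<open>s\<close>, and
  from there on \<open>column_step_bounds\<close> applies. The comparisons between contents
  \<open>corner b - 1\<close> and \<open>corner b\<close> come from its bounds between
  \<open>p\<close> and \<open>s\<close>.\<close>

lemma rpp_column_step:
  assumes cs: "column_step b s m p"
  shows "rpp (Suc b) p"
proof -
  have rs: "\<And>r c. \<not> inD b r c \<Longrightarrow> s r c = 0"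
     "\<And>r c. inD b r c \<Longrightarrow> 0 \<le> s r c \<and> s r (c - 1) \<le> s r c \<and> s (r - 1) (c + 1) \<le> s r c"
     and pz: "\<And>r c. \<not> inD (Suc b) r c \<Longrightarrow> p r c = 0"
     and lo: "\<And>r c. c < corner b \<Longrightarrow> p r c = s r c"
    using cs unfolding column_step_def rpp_def by blast+
  note bd = column_step_bounds[OF cs]
  have "0 \<le> p r c \<and> p r (c - 1) \<le> p r c \<and> p (r - 1) (c + 1) \<le> p r c" if r: "inD (Suc b) r c" for r c
  proof (cases "c < corner b")
    case True
    then have rb: "inD b r c" using r last_column_corner inD_Suc by (meson not_le)
    have "p (r - 1) (c + 1) \<le> s r c"
    proof (cases "c + 1 < corner b")
      case False
      show ?thesis
      proof (cases "inD b (r - 1) (c + 1)")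
        case True then show ?thesis using bd[of "c + 1"] False by force
      next
        case f: False
        then have "\<not> inD (Suc b) (r - 1) (c + 1)" using inD_up[OF rb] unfolding inD_def by auto
        then show ?thesis using pz rs rb by auto
      qed
    qed (use lo rs rb in auto)
    then show ?thesis using lo True rs(2)[OF rb] by auto
  next
    case False
    have "p r (c - 1) \<le> p r c"
    proof (cases "c - 1 < corner b")
      case True then show ?thesis using lo bd[of c] False r by auto
    next
      case f: False
      show ?thesis
      proof (cases "inD b r (c - 1)")
        case True then show ?thesis using bd[of "c - 1"] f by force
      next
        case ff: False
        then have "\<not> inD (Suc b) r (c - 1)" using inD_left[OF r] r unfolding inD_def by auto
        then show ?thesis using pz bd[of c] False r by auto
      qed
    qed
    then show ?thesis using bd[of c] False r by auto
  qed
  then show ?thesis using pz unfolding rpp_def by blast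
qed

section \<open>Inverting the local rule\<close>

function remove_column :: "nat \<Rightarrow> (int \<Rightarrow> int \<Rightarrow> int) \<Rightarrow> int \<Rightarrow> int \<Rightarrow> int" where
  "remove_column b p r c =
     (if \<not> inD b r c then 0
      else if c < corner b then p r c
      else max (p (r - 1) (c + 1)) (remove_column b p r (c - 1))
        + min (p r (c + 1)) (remove_column b p (r + 1) (c - 1)) - p r c)"
  by pat_completeness auto
termination
  \<comment> \<open>Both recursive calls lower the content by one, and below the corner the
    recursion has ended.\<close>
  by (relation "measure (\<lambda>(b, p, r, c). nat (c - corner b + 1))") auto

declare remove_column.simps [simp del]

lemma column_step_unique:
  assumes "column_step b s m p" "column_step b s m' p'"
    and "\<And>r. 1 \<le> r \<Longrightarrow> r \<le> h (int b + 1) \<Longrightarrow> m r = m' r"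
  shows "p = p'"
proof -
  have "\<forall>r. p r c = p' r c" for c
  proof (induction "nat (int b + 1 - c)" arbitrary: c)
    case 0
    then show ?case using assms not_inD_above[of "Suc b" c] unfolding column_step_def by auto
  next
    case (Suc n)
    have IH: "p r (c + 1) = p' r (c + 1)" for r using Suc.hyps by auto
    show ?case
    proof
      fix r
      show "p r c = p' r c"
      proof (cases "inD (Suc b) r c")
        case False then show ?thesis using assms unfolding column_step_def by auto
      next
        case r: True
        show ?thesis
        proof (cases "r + c = int b + 1")
          case True
          then have "m r = m' r" using r assms(3) unfolding inD_def by auto
          then show ?thesis using assms(1,2) r True IH unfolding column_step_def by simp
        next
          case False
          then have rb: "inD b r c" using r inD_Suc by blast
          show ?thesis
          proof (cases "c < corner b")
            case True then show ?thesis using assms(1,2) unfolding column_step_def by simp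
          next
            case False
            then have "p r c + s r c = p' r c + s r c"
              using assms(1,2) rb IH unfolding column_step_def by simp
            then show ?thesis by simp
          qed
        qed
      qed
    qed
  qed
  then show ?thesis by blast
qed

lemma column_step_inject:
  assumes cs: "column_step b s m p" "column_step b s' m' p"
  shows "s = s'" and "\<And>r. 1 \<le> r \<Longrightarrow> r \<le> h (int b + 1) \<Longrightarrow> m r = m' r"
proof -
  have "\<forall>r. s r c = s' r c" for c
  proof (induction "nat (c - corner b + 1)" arbitrary: c)
    case 0
    then show ?case using cs unfolding column_step_def by (smt (verit) nat_0_iff)
  next
    case (Suc n)
    have IH: "s r (c - 1) = s' r (c - 1)" for r using Suc.hyps by auto
    show ?case
    proof
      fix r
      show "s r c = s' r c"
      proof (cases "inD b r c")
        case False then show ?thesis using cs unfolding column_step_def rpp_def by auto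
      next
        case True
        then have "p r c + s r c = p r c + s' r c"
          using cs Suc.hyps(2) IH unfolding column_step_def by simp
        then show ?thesis by simp
      qed
    qed
  qed
  then show s: "s = s'" by blast
  show "m r = m' r" if "1 \<le> r" "r \<le> h (int b + 1)" for r
  proof -
    have "inD (Suc b) r (int b + 1 - r)" using that unfolding inD_def by auto
    then have "int (m r) = int (m' r)" using cs s unfolding column_step_def by (smt (verit))
    then show ?thesis by simp
  qed
qed

lemma remove_column_low:
  assumes p: "rpp (Suc b) p" and c: "c < corner b"
  shows "remove_column b p r c = p r c"
proof (cases "inD b r c")
  case True then show ?thesis using c by (subst remove_column.simps) auto
next
  case False
  then have "\<not> inD (Suc b) r c" using c last_column_corner inD_Suc by (meson not_le)
  then show ?thesis using p False unfolding rpp_def by (subst remove_column.simps) auto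
qed

lemma remove_column_toggle:
  assumes "inD b r c" "corner b \<le> c"
  shows "p r c + remove_column b p r c =
      max (p (r - 1) (c + 1)) (remove_column b p r (c - 1))
        + min (p r (c + 1)) (remove_column b p (r + 1) (c - 1))"
  using assms by (subst remove_column.simps) auto

text \<open>The mirror image of \<open>column_step_bounds\<close>: now \<open>p r c\<close> lies
  between the maximum and the minimum and is reflected to give the entry of
  \<open>remove_column\<close>. The induction runs upward from the contents below the corner, where
  removal changes nothing.\<close>

lemma remove_column_bounds:
  assumes p: "rpp (Suc b) p"
  shows "(\<forall>r. inD b r c \<longrightarrow> p (r - 1) (c + 1) \<le> remove_column b p r c
            \<and> remove_column b p r (c - 1) \<le> remove_column b p r c \<and> 0 \<le> remove_column b p r c) \<and>
         (\<forall>r. inD (Suc b) r (c + 1) \<longrightarrow> remove_column b p r c \<le> p r (c + 1)) \<and>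
         (\<forall>r. inD b r c \<longrightarrow> corner b \<le> c \<longrightarrow> remove_column b p r c \<le> remove_column b p (r + 1) (c - 1))"
    (is "?Q c")
proof (induction "nat (c - corner b + 1)" arbitrary: c)
  case 0
  then have c: "c < corner b" by auto
  then show ?case using p remove_column_low[OF p] inD_Suc unfolding rpp_def
    by (smt (verit, ccfv_threshold))
next
  case (Suc n)
  have c: "corner b \<le> c" using Suc.hyps(2) by auto
  have IH: "?Q (c - 1)" by (rule Suc.hyps(1)) (use Suc.hyps(2) in auto)
  have pz: "\<And>r c. \<not> inD (Suc b) r c \<Longrightarrow> p r c = 0"
    and pm: "\<And>r c. inD (Suc b) r c \<Longrightarrow> 0 \<le> p r c \<and> p r (c - 1) \<le> p r c \<and> p (r - 1) (c + 1) \<le> p r c"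
    using p unfolding rpp_def by blast+
  have p0: "0 \<le> p r c" for r c using pz pm by (cases "inD (Suc b) r c") auto
  let ?S = "remove_column b p"
  have *: "p (r - 1) (c + 1) \<le> ?S r c \<and> ?S r (c - 1) \<le> ?S r c \<and> ?S r c \<le> p r (c + 1) \<and> ?S r c \<le> ?S (r + 1) (c - 1)"
    if r: "inD b r c" for r
  proof -
    note eq = remove_column_toggle[OF r c, of p]
    note l = inD_low[OF r c]
    have r': "inD (Suc b) r c" using r inD_Suc by blast
    have 1: "p (r - 1) (c + 1) \<le> p r c" using pm r' by blast
    have 2: "?S r (c - 1) \<le> p r c" using IH r' by force
    have 3: "p r c \<le> p r (c + 1)" using pm[OF l(2)] by simp
    have 4: "p r c \<le> ?S (r + 1) (c - 1)" using IH l(1) by force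
    show ?thesis using eq 1 2 3 4 by linarith
  qed
  have **: "?S r c \<le> p r (c + 1)" for r
  proof (cases "inD b r c")
    case False then show ?thesis using p0 by (subst remove_column.simps) auto
  qed (use * in blast)
  show ?case using * ** p0 by (smt (verit))
qed

text \<open>The multiplicity in row \<open>r\<close> is the excess of the last-column entry over the
  maximum in the rule. Monotonicity of \<open>p\<close> and \<open>remove_column_bounds\<close> make
  it nonnegative, so \<open>nat\<close> loses nothing.\<close>

lemma column_step_remove_column:
  assumes p: "rpp (Suc b) p"
  defines "S \<equiv> remove_column b p"
  shows "column_step b S (\<lambda>r. let c = int b + 1 - r in nat (p r c - max (p (r - 1) (c + 1)) (S r (c - 1)))) p"
proof -
  note bd = remove_column_bounds[OF p]
  have pz: "\<And>r c. \<not> inD (Suc b) r c \<Longrightarrow> p r c = 0"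
    and pm: "\<And>r c. inD (Suc b) r c \<Longrightarrow> 0 \<le> p r c \<and> p r (c - 1) \<le> p r c \<and> p (r - 1) (c + 1) \<le> p r c"
    using p unfolding rpp_def by blast+
  have Sz: "S r c = 0" if "\<not> inD b r c" for r c
    using that unfolding S_def by (subst remove_column.simps) auto
  have "S (r - 1) (c + 1) \<le> S r c" if r: "inD b r c" for r c
  proof (cases "c + 1 < corner b")
    case True
    then show ?thesis using pm[of r c] r inD_Suc remove_column_low[OF p] unfolding S_def by auto
  next
    case False
    show ?thesis
    proof (cases "inD b (r - 1) (c + 1)")
      case True then show ?thesis using bd[of "c + 1"] False unfolding S_def by force
    next
      case False
      then show ?thesis using bd[of c] r Sz[OF False] unfolding S_def by auto
    qed
  qed
  then have rppS: "rpp b S" using bd Sz unfolding rpp_def S_def by blast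
  have last: "p r c = max (p (r - 1) (c + 1)) (S r (c - 1)) + int (nat (p r c - max (p (r - 1) (c + 1)) (S r (c - 1))))"
    if "inD (Suc b) r c" for r c
  proof -
    have "S r (c - 1) \<le> p r c" using bd[of "c - 1"] that unfolding S_def by auto
    then show ?thesis using pm[OF that] by auto
  qed
  have last': "p r c = max (p (r - 1) (c + 1)) (S r (c - 1)) +
      int (let c = int b + 1 - r in nat (p r c - max (p (r - 1) (c + 1)) (S r (c - 1))))"
    if "inD (Suc b) r c" "r + c = int b + 1" for r c
  proof -
    have "int b + 1 - r = c" using that by simp
    then show ?thesis using last[OF that(1)] unfolding Let_def by simp
  qed
  show ?thesis unfolding column_step_def
    using rppS pz remove_column_low[OF p] remove_column_toggle last' unfolding S_def by auto
qed

section \<open>Fillings by iterated column steps\<close>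

text \<open>The second argument of \<open>m\<close> is a column, whereas that of \<open>f\<close> is
  a content.\<close>

fun fills :: "nat \<Rightarrow> (int \<Rightarrow> int \<Rightarrow> nat) \<Rightarrow> (int \<Rightarrow> int \<Rightarrow> int) \<Rightarrow> bool" where
  "fills 0 m f \<longleftrightarrow> f = (\<lambda>r c. 0)"
| "fills (Suc b) m f \<longleftrightarrow> (\<exists>s. fills b m s \<and> column_step b s (\<lambda>r. m r (int b + 1)) f)"

lemma rpp_0: "rpp 0 f \<longleftrightarrow> f = (\<lambda>r c. 0)"
  unfolding rpp_def inD_def by auto

lemma fills_rpp: "fills b m f \<Longrightarrow> rpp b f"
  by (cases b) (auto simp: rpp_0 intro: rpp_column_step)

lemma fills_unique:
  assumes "fills b m f" "fills b m' f'"
    and "\<And>i j. 1 \<le> i \<Longrightarrow> 1 \<le> j \<Longrightarrow> j \<le> int b \<Longrightarrow> i \<le> h j \<Longrightarrow> m i j = m' i j"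
  shows "f = f'"
  using assms
proof (induction b arbitrary: f f')
  case (Suc b)
  obtain s s' where s: "fills b m s" "column_step b s (\<lambda>r. m r (int b + 1)) f"
    "fills b m' s'" "column_step b s' (\<lambda>r. m' r (int b + 1)) f'"
    using Suc.prems by auto
  have "s = s'" using Suc.IH[OF s(1,3)] Suc.prems(3) by auto
  then show ?case using column_step_unique[OF s(2)] s(4) Suc.prems(3) by auto
qed auto

lemma fills_inject:
  assumes "fills b m f" "fills b m' f" "1 \<le> i" "1 \<le> j" "j \<le> int b" "i \<le> h j"
  shows "m i j = m' i j"
  using assms
proof (induction b arbitrary: f)
  case (Suc b)
  obtain s s' where s: "fills b m s" "column_step b s (\<lambda>r. m r (int b + 1)) f"
    "fills b m' s'" "column_step b s' (\<lambda>r. m' r (int b + 1)) f"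
    using Suc.prems by auto
  have "s = s'" using column_step_inject(1) s by blast
  show ?case
  proof (cases "j = int b + 1")
    case True then show ?thesis using column_step_inject(2)[OF s(2,4)] Suc.prems by auto
  next
    case False then show ?thesis using Suc.IH s \<open>s = s'\<close> Suc.prems by auto
  qed
qed auto

lemma fills_cong:
  assumes "fills b m f" "\<And>i j. j \<le> int b \<Longrightarrow> m i j = m' i j"
  shows "fills b m' f"
  using assms by (induction b arbitrary: f) fastforce+

lemma rpp_fills: "rpp b f \<Longrightarrow> \<exists>m. fills b m f"
proof (induction b arbitrary: f)
  case (Suc b)
  obtain s m where s: "column_step b s m f" using column_step_remove_column[OF Suc.prems] by blast
  then obtain m' where m': "fills b m' s" using Suc.IH unfolding column_step_def by blast
  define m'' where "m'' = (\<lambda>i j. if j = int b + 1 then m i else m' i j)"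
  have "fills b m'' s" by (rule fills_cong[OF m']) (auto simp: m''_def)
  moreover have "(\<lambda>r. m'' r (int b + 1)) = m" by (auto simp: m''_def)
  ultimately have "fills (Suc b) m'' f" using s by auto
  then show ?case by blast
qed (simp add: rpp_0)

section \<open>Insertion paths in content coordinates\<close>

text \<open>The path runs from its tail in row \<open>i\<close> at content \<open>ct\<close> down to
  its head at content \<open>ch\<close>, and \<open>\<rho> c\<close> is its row at content
  \<open>c\<close>. The last clause is the equality that compatibility demands when the path goes
  west at an east step of the boundary.\<close>

definition ins_path :: "nat \<Rightarrow> (int \<Rightarrow> int \<Rightarrow> int) \<Rightarrow> int \<Rightarrow> int \<Rightarrow> int \<Rightarrow> (int \<Rightarrow> int) \<Rightarrow> bool" where
  "ins_path b f i ct ch \<rho> \<longleftrightarrow> \<rho> ct = i \<and> ch \<le> ct \<and>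
     (\<forall>c. ch \<le> c \<longrightarrow> c \<le> ct \<longrightarrow> inD b (\<rho> c) c) \<and>
     (\<forall>c. ch < c \<longrightarrow> c \<le> ct \<longrightarrow>
        \<rho> (c - 1) = (if \<not> estep b c \<and> f (\<rho> c) c = f (\<rho> c + 1) (c - 1) then \<rho> c + 1 else \<rho> c)) \<and>
     (\<forall>c. ch < c \<longrightarrow> c \<le> ct \<longrightarrow> estep b c \<longrightarrow> f (\<rho> c) (c - 1) = f (\<rho> c) c)"

definition bump :: "(int \<Rightarrow> int \<Rightarrow> int) \<Rightarrow> int \<Rightarrow> int \<Rightarrow> (int \<Rightarrow> int) \<Rightarrow> int \<Rightarrow> int \<Rightarrow> int" where
  "bump f ch ct \<rho> r c = f r c + (if ch \<le> c \<and> c \<le> ct \<and> r = \<rho> c then 1 else 0)"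

text \<open>Entries of content at least \<open>corner b - 1\<close> are copied one column to the
  right, so that the diagonal of content \<open>corner b - 1\<close> occurs twice.\<close>

definition shift :: "nat \<Rightarrow> (int \<Rightarrow> int \<Rightarrow> int) \<Rightarrow> int \<Rightarrow> int \<Rightarrow> int" where
  "shift b s r c = (if c < corner b then s r c else if inD (Suc b) r c then s r (c - 1) else 0)"

lemma not_estep:
  assumes "corner b < c" shows "\<not> estep (Suc b) c"
proof
  assume "estep (Suc b) c"
  then obtain j where j: "1 \<le> j" "j \<le> int b + 1" "c = j - h j" unfolding estep_def by auto
  then have "h (int b + 1) \<le> h j" by (intro h_anti)
  then show False using j assms unfolding corner_def by auto
qed

lemma not_estep_old:
  assumes "corner b \<le> c" shows "\<not> estep b c"
proof
  assume "estep b c"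
  then obtain j where j: "1 \<le> j" "j \<le> int b" "c = j - h j" unfolding estep_def by auto
  then have "h (int b + 1) \<le> h j" by (intro h_anti) auto
  then show False using j assms unfolding corner_def by auto
qed

lemma estep_Suc: "estep (Suc b) c \<longleftrightarrow> estep b c \<or> c = corner b"
  unfolding estep_def corner_def by (smt (verit) of_nat_Suc of_nat_0_le_iff)

lemma rpp_diagonal_mono:
  assumes s: "rpp b s" and r: "inD (Suc b) r c"
  shows "s (r - 1) c \<le> s r (c - 1)"
proof (cases "inD b r (c - 1)")
  case True
  then show ?thesis using s unfolding rpp_def by force
next
  case False
  then have "r + c = 1" using r inD_left[OF r] unfolding inD_def by auto
  then have "\<not> inD b (r - 1) c" "\<not> inD b r (c - 1)" unfolding inD_def by auto
  then show ?thesis using s unfolding rpp_def by auto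
qed

lemma rpp_nonneg: "rpp b s \<Longrightarrow> 0 \<le> s r c"
  unfolding rpp_def by (cases "inD b r c") auto

text \<open>From the corner on, \<open>shift b s r c\<close> is \<open>s r (c - 1)\<close>; the
  maximum in the rule is then \<open>s r (c - 1)\<close> and the minimum \<open>s r c\<close>, so
  both sides equal \<open>s r (c - 1) + s r c\<close>.\<close>

lemma column_step_empty:
  assumes s: "rpp b s"
  shows "column_step b s (\<lambda>r. 0) (shift b s)"
proof -
  have sz: "\<And>r c. \<not> inD b r c \<Longrightarrow> s r c = 0"
    and sm: "\<And>r c. inD b r c \<Longrightarrow> 0 \<le> s r c \<and> s r (c - 1) \<le> s r c \<and> s (r - 1) (c + 1) \<le> s r c"
    using s unfolding rpp_def by blast+
  have 1: "shift b s r c = s r (c - 1)" if "inD (Suc b) r c" "corner b \<le> c" for r c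
    using that unfolding shift_def by auto
  have 2: "max (shift b s (r - 1) (c + 1)) (s r (c - 1)) = s r (c - 1)"
    if "inD (Suc b) r c" "corner b \<le> c" for r c
    using that rpp_diagonal_mono[OF s that(1)] rpp_nonneg[OF s, of r "c - 1"] unfolding shift_def by auto
  have 3: "shift b s r c + s r c = max (shift b s (r - 1) (c + 1)) (s r (c - 1)) +
       min (shift b s r (c + 1)) (s (r + 1) (c - 1))" if r: "inD b r c" "corner b \<le> c" for r c
  proof -
    have r': "inD (Suc b) r c" using r inD_Suc by blast
    have "shift b s r (c + 1) = s r c" using 1[of r "c + 1"] inD_low[OF r] r by auto
    moreover have "s r c \<le> s (r + 1) (c - 1)" using sm[OF inD_low(1)[OF r]] by simp
    ultimately show ?thesis using 1 2 r r' by auto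
  qed
  have 4: "shift b s r c = 0" if "\<not> inD (Suc b) r c" for r c
    using that sz inD_Suc unfolding shift_def by auto
  have 5: "shift b s r c = max (shift b s (r - 1) (c + 1)) (s r (c - 1)) + int 0"
    if "inD (Suc b) r c" "r + c = int b + 1" for r c
    using 1 2 that last_column_corner[OF that] by auto
  show ?thesis unfolding column_step_def using s 3 4 5 by (auto simp: shift_def)
qed

text \<open>The path is kept below the corner content and moved one column to the right from there
  on. If it gets that far, the pieces are joined by an east step between contents
  \<open>corner b - 1\<close> and \<open>corner b\<close>, across the equal entries of the repeated
  diagonal. All other comparisons are the old ones.\<close>

lemma ins_path_shift:
  assumes p: "ins_path b s i ct ch \<rho>" and ch: "ch < corner b"
    and ct': "ct' = (if i \<le> h (int b + 1) then ct + 1 else ct)"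
    and tail: "i \<le> h (int b + 1) \<Longrightarrow> ct = int b - i"
  defines "\<rho>' \<equiv> \<lambda>c. if c < corner b then \<rho> c else \<rho> (c - 1)"
  shows "ins_path (Suc b) (shift b s) i ct' ch \<rho>'"
    and "bump (shift b s) ch ct' \<rho>' = shift b (bump s ch ct \<rho>)"
proof -
  have \<rho>: "\<rho> ct = i" "ch \<le> ct" "\<And>c. ch \<le> c \<Longrightarrow> c \<le> ct \<Longrightarrow> inD b (\<rho> c) c"
    "\<And>c. ch < c \<Longrightarrow> c \<le> ct \<Longrightarrow>
        \<rho> (c - 1) = (if \<not> estep b c \<and> s (\<rho> c) c = s (\<rho> c + 1) (c - 1) then \<rho> c + 1 else \<rho> c)"
    "\<And>c. ch < c \<Longrightarrow> c \<le> ct \<Longrightarrow> estep b c \<Longrightarrow> s (\<rho> c) (c - 1) = s (\<rho> c) c"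
    using p unfolding ins_path_def by blast+
  have tl: "inD b i ct" using \<rho>(1-3) by auto
  \<comment> \<open>If row \<open>i\<close> misses column \<open>b + 1\<close>, then
    \<open>i + ct \<le> int b\<close> and \<open>i > h (int b + 1)\<close> put the whole path below
    the corner.\<close>
  have le: "if i \<le> h (int b + 1) then corner b \<le> ct + 1 else ct + 1 < corner b"
    using tl tail unfolding inD_def corner_def by auto
  have low: "r \<le> h (r + c)" if "1 \<le> r" "1 \<le> r + c" "r + c \<le> int b + 1" "corner b \<le> c" for r c
  proof -
    have "h (int b + 1) \<le> h (r + c)" using that by (intro h_anti) auto
    then show ?thesis using that unfolding corner_def by auto
  qed
  have inD': "inD (Suc b) (\<rho>' c) c" if c: "ch \<le> c" "c \<le> ct'" for c
  proof (cases "c < corner b")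
    case True
    then have "c \<le> ct" using c ct' le by (auto split: if_splits)
    then show ?thesis using True \<rho>(3)[OF c(1)] inD_Suc unfolding \<rho>'_def by auto
  next
    case False
    then have "inD b (\<rho> (c - 1)) (c - 1)" using \<rho>(3)[of "c - 1"] c ct' ch le by (auto split: if_splits)
    then show ?thesis using False low[of "\<rho> (c - 1)" c] unfolding \<rho>'_def inD_def by auto
  qed
  have walk: "\<rho>' (c - 1) = (if \<not> estep (Suc b) c \<and> shift b s (\<rho>' c) c = shift b s (\<rho>' c + 1) (c - 1)
      then \<rho>' c + 1 else \<rho>' c)" (is ?w)
    and east: "estep (Suc b) c \<Longrightarrow> shift b s (\<rho>' c) (c - 1) = shift b s (\<rho>' c) c" (is "_ \<Longrightarrow> ?e")
    if c: "ch < c" "c \<le> ct'" for c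
  proof -
    consider "c < corner b" | "c = corner b" | "corner b < c" by linarith
    then have "?w \<and> (estep (Suc b) c \<longrightarrow> ?e)"
    proof cases
      case 1
      then have "c \<le> ct" using c ct' le by (auto split: if_splits)
      then show ?thesis using 1 \<rho>(4,5)[OF c(1)] estep_Suc unfolding \<rho>'_def shift_def by auto
    next
      case 2
      have "inD (Suc b) (\<rho>' c) c" using inD' c by auto
      then show ?thesis using 2 estep_Suc unfolding \<rho>'_def shift_def by auto
    next
      case 3
      then have "c - 1 \<le> ct" using c ct' le by (auto split: if_splits)
      then have old: "\<rho> (c - 1 - 1) = (if s (\<rho> (c - 1)) (c - 1) = s (\<rho> (c - 1) + 1) (c - 1 - 1)
          then \<rho> (c - 1) + 1 else \<rho> (c - 1))"
        using \<rho>(4)[of "c - 1"] not_estep_old[of b "c - 1"] 3 ch by auto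
      have new: "\<not> estep (Suc b) c" using not_estep 3 by auto
      have i1: "inD (Suc b) (\<rho>' c) c" using inD' c by auto
      then have i2: "inD (Suc b) (\<rho>' c + 1) (c - 1)"
        using low[of "\<rho>' c" c] low[of "\<rho>' c + 1" "c - 1"] 3 unfolding inD_def by auto
      show ?thesis using i1 i2 old new 3 unfolding \<rho>'_def shift_def by auto
    qed
    then show ?w "estep (Suc b) c \<Longrightarrow> ?e" by blast+
  qed
  have "\<rho>' ct' = i" using ct' le \<rho>(1) unfolding \<rho>'_def by (auto split: if_splits)
  moreover have "ch \<le> ct'" using ct' \<rho>(2) by auto
  ultimately show "ins_path (Suc b) (shift b s) i ct' ch \<rho>'"
    unfolding ins_path_def using inD' walk east by blast
  show "bump (shift b s) ch ct' \<rho>' = shift b (bump s ch ct \<rho>)"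
  proof (intro ext)
    fix r c
    show "bump (shift b s) ch ct' \<rho>' r c = shift b (bump s ch ct \<rho>) r c"
    proof (cases "c < corner b")
      case True
      then have "c \<le> ct' \<longleftrightarrow> c \<le> ct" using le ct' by (auto split: if_splits)
      then show ?thesis using True unfolding bump_def shift_def \<rho>'_def by auto
    next
      case False
      then have "ch \<le> c \<and> c \<le> ct' \<longleftrightarrow> ch \<le> c - 1 \<and> c - 1 \<le> ct" using le ct' ch by (auto split: if_splits)
      moreover have "\<not> inD (Suc b) r c \<Longrightarrow> \<not> (ch \<le> c \<and> c \<le> ct' \<and> r = \<rho>' c)" using inD' by blast
      ultimately show ?thesis using False unfolding bump_def shift_def \<rho>'_def by auto
    qed
  qed
qed

text \<open>Only equality of entries is tested, because past the corner content the boundary has no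
  east steps.\<close>

fun walk_row :: "(int \<Rightarrow> int \<Rightarrow> int) \<Rightarrow> int \<Rightarrow> int \<Rightarrow> nat \<Rightarrow> int" where
  "walk_row p i ct 0 = i"
| "walk_row p i ct (Suc k) = (let r = walk_row p i ct k; c = ct - int k in
     if p r c = p (r + 1) (c - 1) then r + 1 else r)"

text \<open>A raised entry \<open>p t (c + 1)\<close> enters the rule for its southern neighbour
  through the maximum and the rule for its western neighbour through the minimum, both times against
  \<open>s (t + 1) (c - 1)\<close>. As \<open>s\<close> is fixed, exactly one of these two
  neighbours is raised, and it is the next cell of the insertion path.\<close>

lemma insertion_last_column:
  assumes cs: "column_step b s m p" and m0: "\<And>r. i < r \<Longrightarrow> m r = 0"
    and i: "inD (Suc b) i ct" "i + ct = int b + 1"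
  shows "\<exists>\<rho>. ins_path (Suc b) p i ct (corner b) \<rho> \<and>
     column_step b s (m(i := Suc (m i))) (bump p (corner b) ct \<rho>)"
proof -
  have s: "rpp b s" and pz: "\<And>r c. \<not> inD (Suc b) r c \<Longrightarrow> p r c = 0"
    and lo: "\<And>r c. c < corner b \<Longrightarrow> p r c = s r c"
    and tog: "\<And>r c. inD b r c \<Longrightarrow> corner b \<le> c \<Longrightarrow>
        p r c + s r c = max (p (r - 1) (c + 1)) (s r (c - 1)) + min (p r (c + 1)) (s (r + 1) (c - 1))"
    and lst: "\<And>r c. inD (Suc b) r c \<Longrightarrow> r + c = int b + 1 \<Longrightarrow>
        p r c = max (p (r - 1) (c + 1)) (s r (c - 1)) + int (m r)"
    using cs unfolding column_step_def by blast+
  have p0: "0 \<le> p r c" for r c using rpp_nonneg[OF rpp_column_step[OF cs]] .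
  have sz: "\<And>r c. \<not> inD b r c \<Longrightarrow> s r c = 0"
    and sm: "\<And>r c. inD b r c \<Longrightarrow> 0 \<le> s r c \<and> s r (c - 1) \<le> s r c \<and> s (r - 1) (c + 1) \<le> s r c"
    using s unfolding rpp_def by blast+
  define \<rho> where "\<rho> = (\<lambda>c. walk_row p i ct (nat (ct - c)))"
  have \<rho>0: "\<rho> ct = i" unfolding \<rho>_def by simp
  have \<rho>step: "\<rho> c = (if p (\<rho> (c + 1)) (c + 1) = p (\<rho> (c + 1) + 1) c then \<rho> (c + 1) + 1 else \<rho> (c + 1))"
    if "c < ct" for c
  proof -
    have "nat (ct - c) = Suc (nat (ct - (c + 1)))" "ct - int (nat (ct - (c + 1))) = c + 1" using that by auto
    then show ?thesis unfolding \<rho>_def by (simp add: Let_def)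
  qed
  \<comment> \<open>Below the path \<open>p\<close> is still \<open>s\<close> with a repeated diagonal: this is the row bumping lemma for a
    weakly increasing word. It makes the comparison of entries in the insertion rule agree with the
    maximum in the local rule.\<close>
  define Inv where "Inv = (\<lambda>c. inD (Suc b) (\<rho> c) c \<and>
     (\<forall>r. \<rho> c < r \<longrightarrow> inD (Suc b) r c \<longrightarrow> p r c = s r (c - 1)))"
  have below: "p (t + 1) c = max (p t (c + 1)) (s (t + 1) (c - 1)) \<and> inD (Suc b) (t + 1) c"
    if c: "corner b \<le> c" "c < ct" and inv: "Inv (c + 1)" and t: "t = \<rho> (c + 1)" for c t
  proof -
    have tD: "inD (Suc b) t (c + 1)" using inv t unfolding Inv_def by auto
    then have "h (int b + 1) \<le> h (t + 1 + c)" unfolding inD_def by (intro h_anti) auto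
    then have D: "inD (Suc b) (t + 1) c" using tD c unfolding inD_def corner_def by auto
    show ?thesis
    proof (cases "t + 1 + c = int b + 1")
      case True
      \<comment> \<open>Contents below \<open>ct\<close> meet the last column only in rows below
        \<open>i\<close>, where the multiplicities vanish.\<close>
      then have "m (t + 1) = 0" using m0 i c by auto
      then show ?thesis using lst[OF D True] D by auto
    next
      case False
      then have Db: "inD b (t + 1) c" using D inD_Suc by blast
      \<comment> \<open>This makes \<open>s (t + 1) c\<close> the minimum in the rule, where it
        cancels against the left side.\<close>
      have "p (t + 1) (c + 1) = s (t + 1) c"
        using inD_low(2)[OF Db c(1)] inv t unfolding Inv_def by auto
      moreover have "s (t + 1) c \<le> s (t + 1 + 1) (c - 1)"
        using sm[OF inD_low(1)[OF Db c(1)]] by (simp add: algebra_simps)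
      ultimately show ?thesis using tog[OF Db c(1)] D by auto
    qed
  qed
  have inv: "Inv c" if "corner b \<le> c" "c \<le> ct" for c
    using that
  proof (induction "nat (ct - c)" arbitrary: c)
    case 0
    then have "c = ct" by auto
    then show ?case using \<rho>0 i unfolding Inv_def inD_def by auto
  next
    case (Suc n)
    have c: "c < ct" using Suc.hyps(2) by auto
    have IH: "Inv (c + 1)" by (rule Suc.hyps(1)) (use Suc.hyps(2) Suc.prems in auto)
    define t where "t = \<rho> (c + 1)"
    note bl = below[OF Suc.prems(1) c IH t_def]
    have st: "\<rho> c = (if p t (c + 1) = p (t + 1) c then t + 1 else t)" using \<rho>step[OF c] t_def by simp
    have D: "inD (Suc b) (\<rho> c) c"
    proof (cases "p t (c + 1) = p (t + 1) c")
      case False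
      \<comment> \<open>A west step could leave the shape only into column 0. There \<open>s\<close>
        would be 0, so the nonnegative \<open>p t (c + 1)\<close> would attain the maximum and the
        path would go south instead.\<close>
      then have "s (t + 1) (c - 1) > 0" using bl p0[of t "c + 1"] by auto
      then have "inD b (t + 1) (c - 1)" using sz by fastforce
      moreover have "inD (Suc b) t (c + 1)" using IH unfolding Inv_def t_def by auto
      ultimately have "inD (Suc b) t c" unfolding inD_def by auto
      then show ?thesis using st False by simp
    qed (use st bl in simp)
    have "p r c = s r (c - 1)" if r: "\<rho> c < r" "inD (Suc b) r c" for r
    proof (cases "r = t + 1")
      case True then show ?thesis using st r bl by (auto split: if_splits)
    next
      case False
      then have rt: "t < r - 1" using st r by (auto split: if_splits)
      have up: "p (r - 1) (c + 1) = s (r - 1) c"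
      proof -
        have "0 \<le> t" using IH unfolding Inv_def t_def inD_def by auto
        then have "inD (Suc b) (r - 1) (c + 1)" using r(2) rt unfolding inD_def by auto
        then show ?thesis using IH rt unfolding Inv_def t_def by auto
      qed
      have mono: "s (r - 1) c \<le> s r (c - 1)" using rpp_diagonal_mono[OF s r(2)] .
      show ?thesis
      proof (cases "r + c = int b + 1")
        case True
        then have "m r = 0" using m0 i c by auto
        then show ?thesis using lst[OF r(2) True] up mono by auto
      next
        case False
        then have Db: "inD b r c" using r inD_Suc by blast
        have "p r (c + 1) = s r c"
          using inD_low(2)[OF Db Suc.prems(1)] IH rt unfolding Inv_def t_def by auto
        moreover have "s r c \<le> s (r + 1) (c - 1)"
          using sm[OF inD_low(1)[OF Db Suc.prems(1)]] by simp
        ultimately show ?thesis using tog[OF Db Suc.prems(1)] up mono by auto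
      qed
    qed
    then show ?case using D unfolding Inv_def by blast
  qed
  have ctc: "corner b \<le> ct" using last_column_corner i by auto
  have path: "ins_path (Suc b) p i ct (corner b) \<rho>"
    unfolding ins_path_def
  proof (intro conjI allI impI)
    fix c assume c: "corner b < c" "c \<le> ct"
    show "\<rho> (c - 1) = (if \<not> estep (Suc b) c \<and> p (\<rho> c) c = p (\<rho> c + 1) (c - 1) then \<rho> c + 1 else \<rho> c)"
      using \<rho>step[of "c - 1"] not_estep[OF c(1)] c by auto
    show "p (\<rho> c) (c - 1) = p (\<rho> c) c" if "estep (Suc b) c" using that not_estep[OF c(1)] by auto
  qed (use \<rho>0 ctc inv in \<open>auto simp: Inv_def\<close>)
  define q where "q = bump p (corner b) ct \<rho>"
  have qhi: "q r c = p r c" if "ct < c" for r c using that unfolding q_def bump_def by auto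
  have qin: "q r c = p r c + (if r = \<rho> c then 1 else 0)" if "corner b \<le> c" "c \<le> ct" for r c
    using that unfolding q_def bump_def by auto
  \<comment> \<open>A tie sends the path south: raising \<open>p t (c + 1)\<close> then raises the
    maximum but not the minimum.\<close>
  have change: "(\<rho> c = t + 1 \<and> s (t + 1) (c - 1) \<le> p t (c + 1)) \<or> (\<rho> c = t \<and> p t (c + 1) < s (t + 1) (c - 1))"
    if "corner b \<le> c" "c < ct" "t = \<rho> (c + 1)" for c t
    using below[OF that(1,2) inv that(3)] \<rho>step[OF that(2)] that by (auto split: if_splits)
  have "column_step b s (m(i := Suc (m i))) q"
    unfolding column_step_def
  proof (intro conjI allI impI)
    show "rpp b s" by fact
    fix r c
    show "q r c = 0" if "\<not> inD (Suc b) r c"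
      using that inv pz unfolding q_def bump_def Inv_def by auto
    show "q r c = s r c" if "c < corner b" using that lo unfolding q_def bump_def by auto
    show "q r c + s r c = max (q (r - 1) (c + 1)) (s r (c - 1)) + min (q r (c + 1)) (s (r + 1) (c - 1))"
      if r: "inD b r c" "corner b \<le> c"
    proof -
      note eq = tog[OF r]
      consider "ct < c" | "c = ct" | "c < ct" by linarith
      then show ?thesis
      proof cases
        case 1 then show ?thesis using eq by (simp add: qhi)
      next
        case 2
        then have "r \<noteq> i" using r i unfolding inD_def by auto
        then show ?thesis using 2 eq \<rho>0 qin[OF r(2)] by (simp add: qhi)
      next
        case 3
        define t where "t = \<rho> (c + 1)"
        have q1: "q r' (c + 1) = p r' (c + 1) + (if r' = t then 1 else 0)" for r'
          using qin[of "c + 1"] r 3 t_def by auto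
        have q2: "q r c = p r c + (if r = \<rho> c then 1 else 0)" using qin r 3 by auto
        consider "\<rho> c = t + 1" "s (t + 1) (c - 1) \<le> p t (c + 1)"
          | "\<rho> c = t" "p t (c + 1) < s (t + 1) (c - 1)"
          using change[OF r(2) 3 t_def] by blast
        then show ?thesis
        proof cases
          case 1
          have "q r c = p r c + (if r - 1 = t then 1 else 0)" using q2 1 by simp
          moreover have "r - 1 = t \<Longrightarrow> s r (c - 1) \<le> p (r - 1) (c + 1)" using 1 by auto
          moreover have "r = t \<Longrightarrow> s (r + 1) (c - 1) \<le> p r (c + 1)" using 1 by auto
          ultimately show ?thesis unfolding q1[of r] q1[of "r - 1"] using eq by (smt (verit, best))
        next
          case 2
          have "q r c = p r c + (if r = t then 1 else 0)" using q2 2 by simp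
          moreover have "r - 1 = t \<Longrightarrow> p (r - 1) (c + 1) < s r (c - 1)" using 2 by auto
          moreover have "r = t \<Longrightarrow> p r (c + 1) < s (r + 1) (c - 1)" using 2 by auto
          ultimately show ?thesis unfolding q1[of r] q1[of "r - 1"] using eq by (smt (verit, best))
        qed
      qed
    qed
    show "q r c = max (q (r - 1) (c + 1)) (s r (c - 1)) + int ((m(i := Suc (m i))) r)"
      if r: "inD (Suc b) r c" "r + c = int b + 1"
    proof -
      note eq = lst[OF r]
      have cc: "corner b \<le> c" using last_column_corner r by auto
      consider "ct < c" | "c = ct" | "c < ct" by linarith
      then show ?thesis
      proof cases
        case 1
        then have "r \<noteq> i" using r i by auto
        then show ?thesis using eq 1 by (simp add: qhi)
      next
        case 2
        then have "r = i" using r i by auto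
        then show ?thesis using 2 eq \<rho>0 qin[OF cc] by (simp add: qhi)
      next
        case 3
        define t where "t = \<rho> (c + 1)"
        have q1: "q r' (c + 1) = p r' (c + 1) + (if r' = t then 1 else 0)" for r'
          using qin[of "c + 1"] cc 3 t_def by auto
        have q2: "q r c = p r c + (if r = \<rho> c then 1 else 0)" using qin cc 3 by auto
        have "m r = 0" "r \<noteq> i" using r i 3 m0 by auto
        moreover have "r \<noteq> t" using inv[of "c + 1"] 3 cc r unfolding Inv_def t_def inD_def by auto
        moreover have "r - 1 = t \<Longrightarrow> r = \<rho> c \<and> s r (c - 1) \<le> p (r - 1) (c + 1) \<or>
            r \<noteq> \<rho> c \<and> p (r - 1) (c + 1) < s r (c - 1)"
          using change[OF cc 3 t_def] by auto
        moreover have "r - 1 \<noteq> t \<Longrightarrow> r \<noteq> t \<Longrightarrow> r \<noteq> \<rho> c"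
          using change[OF cc 3 t_def] by auto
        ultimately show ?thesis unfolding q1[of "r - 1"] q2 using eq by (smt (verit, best) fun_upd_other)
      qed
    qed
  qed
  then show ?thesis using path q_def by blast
qed

text \<open>Induction on the number of columns. In the last column
  \<open>insertion_last_column\<close> applies. Otherwise the last column carries multiplicity 0,
  \<open>f\<close> is a shift, and \<open>ins_path_shift\<close> carries the path over. The final
  assumption says that no cell strictly before \<open>(i, j)\<close> in the order of cells has been
  used.\<close>

lemma fills_insert:
  assumes "fills b m f" "inD b i (j - i)" "inD b i ct" "\<not> inD b i (ct + 1)"
    and "\<And>i' j'. j < j' \<or> j' = j \<and> i < i' \<Longrightarrow> m i' j' = 0"
  shows "\<exists>\<rho>. ins_path b f i ct (j - h j) \<rho> \<and>
     fills b (\<lambda>i' j'. m i' j' + (if i' = i \<and> j' = j then 1 else 0)) (bump f (j - h j) ct \<rho>)"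
  using assms
proof (induction b arbitrary: f ct)
  case 0
  then show ?case unfolding inD_def by auto
next
  case (Suc b)
  obtain s where s: "fills b m s" "column_step b s (\<lambda>r. m r (int b + 1)) f" using Suc.prems(1) by auto
  let ?m = "\<lambda>i' j'. m i' j' + (if i' = i \<and> j' = j then 1 else 0)"
  show ?case
  proof (cases "j = int b + 1")
    case True
    have h: "i \<le> h (int b + 1)" "1 \<le> i" using Suc.prems(2) True unfolding inD_def by auto
    have ct: "i + ct = int b + 1"
    proof (rule ccontr)
      assume "i + ct \<noteq> int b + 1"
      then have "inD (Suc b) i (ct + 1)" using Suc.prems(3) h h_anti[of "i + (ct + 1)" "int b + 1"]
        unfolding inD_def by (auto simp: algebra_simps)
      then show False using Suc.prems(4) by blast
    qed
    have "\<exists>\<rho>. ins_path (Suc b) f i ct (corner b) \<rho> \<and>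
       column_step b s ((\<lambda>r. m r (int b + 1))(i := Suc (m i (int b + 1)))) (bump f (corner b) ct \<rho>)"
      by (rule insertion_last_column[OF s(2) _ Suc.prems(3) ct]) (use Suc.prems(5) True in auto)
    moreover have "(\<lambda>r. m r (int b + 1))(i := Suc (m i (int b + 1))) = (\<lambda>r. ?m r (int b + 1))"
      using True by auto
    moreover have "fills b ?m s" by (rule fills_cong[OF s(1)]) (use True in auto)
    moreover have "corner b = j - h j" unfolding corner_def using True by simp
    ultimately show ?thesis by auto
  next
    case False
    have D: "inD b i (j - i)" using Suc.prems(2) False unfolding inD_def by auto
    have jb: "1 \<le> j" "j \<le> int b" "1 \<le> i" using D unfolding inD_def by auto
    have "h (int b + 1) \<le> h j" using jb by (intro h_anti) auto
    then have ch: "j - h j < corner b" using jb unfolding corner_def by auto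
    have fs: "f = shift b s"
      using column_step_unique[OF s(2) column_step_empty[OF fills_rpp[OF s(1)]]] Suc.prems(5) jb by auto
    \<comment> \<open>The end of row \<open>i\<close> within the first \<open>b\<close> columns: a
      row that meets column \<open>b + 1\<close> also meets column \<open>b\<close>.\<close>
    define ct0 where "ct0 = (if i \<le> h (int b + 1) then int b - i else ct)"
    have full: "inD (Suc b) i (int b + 1 - i)" "inD b i (int b - i)" if "i \<le> h (int b + 1)"
      using that jb h_anti[of "int b" "int b + 1"] unfolding inD_def by auto
    have ctfull: "ct = int b + 1 - i" if le: "i \<le> h (int b + 1)"
    proof (rule ccontr)
      assume "ct \<noteq> int b + 1 - i"
      then have "inD (Suc b) i (ct + 1)" using Suc.prems(3) le h_anti[of "i + (ct + 1)" "int b + 1"]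
        unfolding inD_def by (auto simp: algebra_simps)
      then show False using Suc.prems(4) by blast
    qed
    have ct0D: "inD b i ct0" "\<not> inD b i (ct0 + 1)"
    proof -
      show "inD b i ct0" using full Suc.prems(3) inD_Suc unfolding ct0_def by auto
      show "\<not> inD b i (ct0 + 1)" using Suc.prems(4) inD_Suc unfolding ct0_def by (auto simp: inD_def)
    qed
    obtain \<rho> where \<rho>: "ins_path b s i ct0 (j - h j) \<rho>" "fills b ?m (bump s (j - h j) ct0 \<rho>)"
      using Suc.IH[OF s(1) D ct0D Suc.prems(5)] by blast
    define \<rho>' where "\<rho>' = (\<lambda>c. if c < corner b then \<rho> c else \<rho> (c - 1))"
    have c: "ct = (if i \<le> h (int b + 1) then ct0 + 1 else ct0)" using ctfull unfolding ct0_def by auto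
    have c': "i \<le> h (int b + 1) \<Longrightarrow> ct0 = int b - i" unfolding ct0_def by simp
    note sh = ins_path_shift[OF \<rho>(1) ch c c', folded \<rho>'_def fs]
    have "column_step b (bump s (j - h j) ct0 \<rho>) (\<lambda>r. 0) (bump f (j - h j) ct \<rho>')"
      using column_step_empty[OF fills_rpp[OF \<rho>(2)]] sh(2) by simp
    moreover have "(\<lambda>r. ?m r (int b + 1)) = (\<lambda>r. 0)" using Suc.prems(5) jb by auto
    ultimately have "fills (Suc b) ?m (bump f (j - h j) ct \<rho>')" using \<rho>(2) by auto
    then show ?thesis using sh(1) by blast
  qed
qed

end

section \<open>The regions and the boundary of the shape\<close>

text \<open>The entry at index \<open>k\<close> is below \<open>c\<close> exactly when the
  \<open>k + 1\<close> smallest elements are. This turns comparisons with listed corner contents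
  into counts of corners.\<close>

lemma sorted_list_of_set_nth_less_iff:
  fixes S :: "int set"
  assumes S: "finite S" and k: "k < card S"
  shows "sorted_list_of_set S ! k < c \<longleftrightarrow> k < card {x \<in> S. x < c}"
proof -
  let ?xs = "sorted_list_of_set S"
  have len: "length ?xs = card S" and set: "set ?xs = S" using S by auto
  have mono: "?xs ! i < ?xs ! j" if "i < j" "j < card S" for i j
    using that strict_sorted_list_of_set[of S] len sorted_wrt_nth_less by metis
  have inj: "inj_on ((!) ?xs) {..<card S}"
    by (rule inj_onI) (metis lessThan_iff mono linorder_neqE_nat less_irrefl)
  show ?thesis
  proof
    assume "?xs ! k < c"
    then have "?xs ! i < c" if "i \<le> k" for i using mono[of i k] k that by (cases "i = k") auto
    moreover have "?xs ! i \<in> S" if "i \<le> k" for i using nth_mem[of i ?xs] set len k that by auto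
    ultimately have "(!) ?xs ` {..k} \<subseteq> {x \<in> S. x < c}" by auto
    moreover have "card ((!) ?xs ` {..k}) = Suc k"
      using card_image[OF inj_on_subset[OF inj, of "{..k}"]] k by fastforce
    ultimately show "k < card {x \<in> S. x < c}"
      using card_mono[of "{x \<in> S. x < c}" "(!) ?xs ` {..k}"] S by auto
  next
    assume a: "k < card {x \<in> S. x < c}"
    show "?xs ! k < c"
    proof (rule ccontr)
      assume n: "\<not> ?xs ! k < c"
      have "{x \<in> S. x < c} \<subseteq> (!) ?xs ` {..<k}"
      proof
        fix x assume "x \<in> {x \<in> S. x < c}"
        then obtain i where "i < card S" "?xs ! i = x" "x < c" using set len by (metis (mono_tags, lifting) in_set_conv_nth mem_Collect_eq)
        moreover then have "i < k" using n mono[of k i] by (metis linorder_neqE_nat less_trans)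
        ultimately show "x \<in> (!) ?xs ` {..<k}" by auto
      qed
      then have "card {x \<in> S. x < c} \<le> card {..<k}" by (meson card_image_le card_mono finite_imageI finite_lessThan le_trans)
      then show False using a by auto
    qed
  qed
qed

lemma card_less_Suc:
  fixes S :: "int set"
  assumes "finite S"
  shows "card {x \<in> S. x < c + 1} = card {x \<in> S. x < c} + (if c \<in> S then 1 else 0)"
proof (cases "c \<in> S")
  case True
  then have "{x \<in> S. x < c + 1} = insert c {x \<in> S. x < c}" by auto
  then show ?thesis using True assms by simp
next
  case False
  have "{x \<in> S. x < c + 1} = {x \<in> S. x < c}"
  proof (rule Collect_cong)
    fix x show "x \<in> S \<and> x < c + 1 \<longleftrightarrow> x \<in> S \<and> x < c" using False by (cases "x = c") auto
  qed
  then show ?thesis using False by simp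
qed

section \<open>Corners of a word of east and north steps\<close>

locale boundary_word =
  fixes e :: "int \<Rightarrow> bool" and l u :: int
  assumes lu: "l \<le> u" and e_l: "e l" and e_u: "\<not> e (u + 1)"
begin

text \<open>For the boundary of a shape, east followed by north is an outer corner and north
  followed by east an inner one.\<close>

definition "Out = {c. l \<le> c \<and> c \<le> u \<and> e c \<and> \<not> e (c + 1)}"
definition "Inn = {c. l \<le> c \<and> c \<le> u \<and> \<not> e c \<and> e (c + 1)}"

lemma finite_corners: "finite Out" "finite Inn"
  unfolding Out_def Inn_def by (rule finite_subset[of _ "{l..u}"]; auto)+

text \<open>The two kinds of corners alternate, beginning with an outer one because the word begins
  with an east step. So the counts agree while the current step is east and differ by one while it
  is north.\<close>

lemma count_corners:
  assumes "l \<le> c" "c \<le> u + 1"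
  shows "card {x \<in> Out. x < c} = card {x \<in> Inn. x < c} + (if e c then 0 else 1)"
  using assms
proof (induction c rule: int_ge_induct)
  case base
  have "{x \<in> Out. x < l} = {}" "{x \<in> Inn. x < l} = {}" unfolding Out_def Inn_def by auto
  then show ?case using e_l by (simp only: card.empty) simp
next
  case (step c)
  then show ?case
    using card_less_Suc[OF finite_corners(1), of c] card_less_Suc[OF finite_corners(2), of c]
    unfolding Out_def Inn_def by auto
qed

lemma card_corners: "card Out = Suc (card Inn)"
proof -
  have "{x \<in> Out. x < u + 1} = Out" "{x \<in> Inn. x < u + 1} = Inn" unfolding Out_def Inn_def by auto
  then show ?thesis using count_corners[of "u + 1"] lu e_u by auto
qed

lemma nth_iff:
  shows "k \<le> card Inn \<Longrightarrow> sorted_list_of_set Out ! k < c \<longleftrightarrow> k < card {x \<in> Out. x < c}"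
    and "k < card Inn \<Longrightarrow> sorted_list_of_set Inn ! k < c \<longleftrightarrow> k < card {x \<in> Inn. x < c}"
    and "k \<le> card Inn \<Longrightarrow> c < sorted_list_of_set Out ! k \<longleftrightarrow> card {x \<in> Out. x < c + 1} \<le> k"
    and "k < card Inn \<Longrightarrow> c < sorted_list_of_set Inn ! k \<longleftrightarrow> card {x \<in> Inn. x < c + 1} \<le> k"
  using sorted_list_of_set_nth_less_iff[OF finite_corners(1), of k c] card_corners
    sorted_list_of_set_nth_less_iff[OF finite_corners(1), of k "c + 1"]
    sorted_list_of_set_nth_less_iff[OF finite_corners(2), of k c]
    sorted_list_of_set_nth_less_iff[OF finite_corners(2), of k "c + 1"]
  by linarith+

text \<open>In terms of counts, the outer corners up to \<open>c\<close> are at most as many as the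
  inner corners before \<open>c\<close>; by \<open>count_corners\<close> this happens only between
  two east steps.\<close>

lemma between_corners_A:
  assumes c: "l \<le> c" "c \<le> u"
  shows "c < sorted_list_of_set Out ! 0 \<or>
     (\<exists>k < card Inn. sorted_list_of_set Inn ! k < c \<and> c < sorted_list_of_set Out ! Suc k)
     \<longleftrightarrow> e c \<and> e (c + 1)" (is "?L \<longleftrightarrow> _")
proof -
  let ?i = "card {x \<in> Inn. x < c}" and ?o = "card {x \<in> Out. x < c + 1}"
  have "?i \<le> card Inn" using finite_corners by (intro card_mono) auto
  then have "?L \<longleftrightarrow> ?o = 0 \<or> (\<exists>k < card Inn. k < ?i \<and> ?o \<le> Suc k)"
    by (auto simp: nth_iff)
  \<comment> \<open>The index to try is \<open>?i - 1\<close>; for \<open>?i = 0\<close> the first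
    disjunct remains.\<close>
  also have "\<dots> \<longleftrightarrow> ?o \<le> ?i"
    using \<open>?i \<le> card Inn\<close> by presburger
  also have "\<dots> \<longleftrightarrow> e c \<and> e (c + 1)"
    using count_corners[of "c + 1"] card_less_Suc[OF finite_corners(2), of c] c unfolding Inn_def by auto
  finally show ?thesis .
qed

lemma between_corners_B:
  assumes c: "l \<le> c" "c \<le> u"
  shows "(\<exists>k < card Inn. sorted_list_of_set Out ! k < c \<and> c < sorted_list_of_set Inn ! k) \<or>
     sorted_list_of_set Out ! card Inn < c
     \<longleftrightarrow> \<not> e c \<and> \<not> e (c + 1)" (is "?L \<longleftrightarrow> _")
proof -
  let ?i = "card {x \<in> Inn. x < c + 1}" and ?o = "card {x \<in> Out. x < c}"
  have "?i \<le> card Inn" using finite_corners by (intro card_mono) auto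
  have "?L \<longleftrightarrow> (\<exists>k < card Inn. k < ?o \<and> ?i \<le> k) \<or> card Inn < ?o"
    by (auto simp: nth_iff)
  \<comment> \<open>The index to try is \<open>?i\<close>; when this counts all inner corners, the
    last disjunct takes over.\<close>
  also have "\<dots> \<longleftrightarrow> ?i < ?o"
    using \<open>?i \<le> card Inn\<close> by presburger
  also have "\<dots> \<longleftrightarrow> \<not> e c \<and> \<not> e (c + 1)"
    using count_corners[of c] card_less_Suc[OF finite_corners(2), of c] c unfolding Inn_def by auto
  finally show ?thesis .
qed

end

section \<open>The boundary of a partition shape\<close>

lemma down_closed_card:
  fixes S :: "int set"
  assumes "finite S" "\<And>i. i \<in> S \<Longrightarrow> 1 \<le> i" "\<And>i k. i \<in> S \<Longrightarrow> 1 \<le> k \<Longrightarrow> k \<le> i \<Longrightarrow> k \<in> S"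
  shows "i \<in> S \<longleftrightarrow> 1 \<le> i \<and> i \<le> int (card S)"
proof (cases "S = {}")
  case False
  have "x \<in> S \<longleftrightarrow> x \<in> {1..Max S}" for x
    using assms(2)[of x] assms(3)[OF Max_in[OF assms(1) False], of x] Max_ge[OF assms(1), of x]
    by (metis atLeastAtMost_iff)
  then obtain M where M: "S = {1..M}" by blast
  moreover have "1 \<le> M" using M False by auto
  ultimately show ?thesis by simp
qed simp

locale partition_shape =
  fixes lam :: "nat list"
  assumes partition: "is_partition lam"
begin

sublocale heights "conj_part lam"
proof
  fix j k :: int
  assume "j \<le> k"
  then show "conj_part lam k \<le> conj_part lam j"
    unfolding conj_part_def by (auto intro!: card_mono finite_subset[of _ "{1..int (length lam)}"])
qed

definition "B = nat (part lam 1)"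

lemma part_anti:
  assumes "1 \<le> i" "i \<le> k" "k \<le> int (length lam)"
  shows "part lam k \<le> part lam i"
proof (cases "i = k")
  case False
  have "sorted_wrt (\<ge>) lam" using partition unfolding is_partition_def by blast
  then have "lam ! nat (i - 1) \<ge> lam ! nat (k - 1)"
    using assms False by (auto intro: sorted_wrt_nth_less)
  then show ?thesis using assms unfolding part_def by auto
qed simp

text \<open>The rows reaching column \<open>j\<close> form an initial segment, so counting them
  gives the last one.\<close>

lemma le_conj_part: "1 \<le> i \<and> i \<le> int (length lam) \<and> j \<le> part lam i \<longleftrightarrow> 1 \<le> i \<and> i \<le> conj_part lam j"
proof -
  let ?S = "{i. 1 \<le> i \<and> i \<le> int (length lam) \<and> j \<le> part lam i}"
  have "i \<in> ?S \<longleftrightarrow> 1 \<le> i \<and> i \<le> int (card ?S)"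
    by (rule down_closed_card) (use part_anti in \<open>auto intro: order_trans finite_subset[of _ "{1..int (length lam)}"]\<close>)
  then show ?thesis unfolding conj_part_def by auto
qed

lemma diagram_iff: "(i, j) \<in> diagram lam \<longleftrightarrow> inD B i (j - i)"
proof -
  have "(i, j) \<in> diagram lam \<longleftrightarrow> 1 \<le> j \<and> 1 \<le> i \<and> i \<le> conj_part lam j"
    using le_conj_part[of i j] unfolding diagram_def by auto
  moreover have "j \<le> int B" if "1 \<le> i" "i \<le> conj_part lam j" "1 \<le> j"
    using le_conj_part[of i j] that part_anti[of 1 i] unfolding B_def by auto
  ultimately show ?thesis unfolding inD_def by auto
qed

lemma conj_part_pos: "1 \<le> j \<Longrightarrow> j \<le> int B \<Longrightarrow> 1 \<le> conj_part lam j"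
  using le_conj_part[of 1 j] unfolding B_def by (auto simp: part_def split: if_splits)

lemma in_diagram: "(i, j) \<in> diagram lam \<longleftrightarrow> 1 \<le> i \<and> 1 \<le> j \<and> j \<le> int B \<and> i \<le> conj_part lam j"
  unfolding diagram_iff inD_def by auto

text \<open>The contents \<open>j - conj_part lam j\<close> of the column bottoms increase strictly
  with \<open>j\<close>, so the interval contains no other east step.\<close>

lemma estep_between:
  assumes "1 \<le> j" "j - conj_part lam j \<le> c" "c < j + 1 - conj_part lam (j + 1) \<or> int B < j + 1"
  shows "estep B c \<longleftrightarrow> c = j - conj_part lam j \<and> j \<le> int B"
proof -
  have "k = j" if "1 \<le> k" "k \<le> int B" "c = k - conj_part lam k" for k
    using assms that h_anti[of k j] h_anti[of "j + 1" k] by (cases k j rule: linorder_cases) auto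
  then show ?thesis unfolding estep_def using assms by metis
qed

text \<open>The contents of the bottom cell of the first column and of the last cell of the first
  row.\<close>

definition "lo = 1 - conj_part lam 1"
definition "hi = int B - 1"

lemma content_range:
  assumes "(i, j) \<in> diagram lam" shows "lo \<le> j - i" "j - i \<le> hi"
  using assms h_anti[of 1 j] unfolding in_diagram lo_def hi_def by auto

lemma boundary_word:
  assumes "(i, j) \<in> diagram lam"
  shows "boundary_word (estep B) lo hi"
proof
  have B: "1 \<le> int B" using assms unfolding in_diagram by auto
  show "lo \<le> hi" using content_range[OF assms] by auto
  show "estep B lo" unfolding estep_def lo_def using B by auto
  show "\<not> estep B (hi + 1)" unfolding estep_def hi_def using conj_part_pos by force
qed

lemma outer_corner_contents:
  "content ` {u. outer_corner lam u} = {c. lo \<le> c \<and> c \<le> hi \<and> estep B c \<and> \<not> estep B (c + 1)}"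
proof (intro equalityI subsetI)
  fix c assume "c \<in> content ` {u. outer_corner lam u}"
  then obtain i j where c: "c = j - i" and u: "(i, j) \<in> diagram lam" "(i, j + 1) \<notin> diagram lam" "(i + 1, j) \<notin> diagram lam"
    unfolding content_def outer_corner_def ee_def ss_def by auto
  have i: "i = conj_part lam j" using u unfolding in_diagram by auto
  have j: "1 \<le> j" "j \<le> int B" "1 \<le> i" "int B < j + 1 \<or> conj_part lam (j + 1) < i" using u unfolding in_diagram by auto
  show "c \<in> {c. lo \<le> c \<and> c \<le> hi \<and> estep B c \<and> \<not> estep B (c + 1)}"
    using content_range[OF u(1)] estep_between[of j c] estep_between[of j "c + 1"] i j c by auto
next
  fix c assume "c \<in> {c. lo \<le> c \<and> c \<le> hi \<and> estep B c \<and> \<not> estep B (c + 1)}"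
  then obtain j where j: "1 \<le> j" "j \<le> int B" "c = j - conj_part lam j" and n: "\<not> estep B (c + 1)"
    unfolding estep_def by auto
  have "\<not> (j + 1 \<le> int B \<and> conj_part lam j \<le> conj_part lam (j + 1))"
    using n h_anti[of j "j + 1"] j unfolding estep_def by (smt (verit))
  then have "outer_corner lam (conj_part lam j, j)"
    using j conj_part_pos[of j] unfolding outer_corner_def in_diagram ee_def ss_def by auto
  then show "c \<in> content ` {u. outer_corner lam u}" using j unfolding content_def by force
qed

lemma inner_corner_contents:
  "content ` {u. inner_corner lam u} = {c. lo \<le> c \<and> c \<le> hi \<and> \<not> estep B c \<and> estep B (c + 1)}"
proof (intro equalityI subsetI)
  fix c assume "c \<in> content ` {u. inner_corner lam u}"
  then obtain i j where c: "c = j - i" and u: "(i, j) \<in> diagram lam" "(i, j + 1) \<in> diagram lam" "(i + 1, j) \<in> diagram lam" "(i + 1, j + 1) \<notin> diagram lam"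
    unfolding content_def inner_corner_def ee_def ss_def by auto
  have i: "i = conj_part lam (j + 1)" "i + 1 \<le> conj_part lam j" using u unfolding in_diagram by auto
  have j: "1 \<le> j" "j + 1 \<le> int B" using u unfolding in_diagram by auto
  have "estep B (c + 1)" unfolding estep_def using i j c by (intro exI[of _ "j + 1"]) auto
  moreover have "\<not> estep B c" using estep_between[of j c] i j c by auto
  ultimately show "c \<in> {c. lo \<le> c \<and> c \<le> hi \<and> \<not> estep B c \<and> estep B (c + 1)}"
    using content_range[OF u(1)] c by auto
next
  fix c assume c: "c \<in> {c. lo \<le> c \<and> c \<le> hi \<and> \<not> estep B c \<and> estep B (c + 1)}"
  then obtain j where j: "1 \<le> j" "j \<le> int B" "c + 1 = j - conj_part lam j" and n: "\<not> estep B c"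
    unfolding estep_def by auto
  \<comment> \<open>The east step of column 1 is at content \<open>lo\<close>, while
    \<open>c + 1\<close> exceeds \<open>lo\<close>.\<close>
  have "j \<noteq> 1" using c j unfolding lo_def by auto
  then have j1: "1 \<le> j - 1" using j by auto
  have "conj_part lam j < conj_part lam (j - 1)"
    using n h_anti[of "j - 1" j] j j1 unfolding estep_def by (smt (verit))
  then have "inner_corner lam (conj_part lam j, j - 1)"
    using j j1 conj_part_pos[of j] unfolding inner_corner_def in_diagram ee_def ss_def by auto
  then show "c \<in> content ` {u. inner_corner lam u}" using j unfolding content_def by force
qed

text \<open>At the boundary vertex of its content, a cell of \<open>region_I\<close> sees north then
  east, of \<open>region_A\<close> east twice, of \<open>region_B\<close> north twice. The two
  unions needed for compatibility and for the walk thus depend on a single step each.\<close>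

lemma regions:
  assumes u: "(i, j) \<in> diagram lam"
  shows "(i, j) \<in> region_I lam \<union> region_A lam \<longleftrightarrow> estep B (j - i + 1)"
    and "(i, j) \<in> region_B lam \<union> region_I lam \<longleftrightarrow> \<not> estep B (j - i)"
proof -
  interpret bw: boundary_word "estep B" lo hi by (rule boundary_word[OF u])
  note r = content_range[OF u]
  have O: "outer_contents lam = sorted_list_of_set bw.Out"
    unfolding outer_contents_def outer_corner_contents bw.Out_def ..
  have I: "inner_contents lam = sorted_list_of_set bw.Inn"
    unfolding inner_contents_def inner_corner_contents bw.Inn_def ..
  have 1: "(i, j) \<in> region_I lam \<longleftrightarrow> \<not> estep B (j - i) \<and> estep B (j - i + 1)"
    using u r bw.finite_corners unfolding region_I_def I content_def by (auto simp: bw.Inn_def)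
  have 2: "(i, j) \<in> region_A lam \<longleftrightarrow> estep B (j - i) \<and> estep B (j - i + 1)"
    using u bw.between_corners_A[OF r] bw.finite_corners unfolding region_A_def O I content_def by simp
  have 3: "(i, j) \<in> region_B lam \<longleftrightarrow> \<not> estep B (j - i) \<and> \<not> estep B (j - i + 1)"
    using u bw.between_corners_B[OF r] bw.finite_corners unfolding region_B_def O I content_def by simp
  show "(i, j) \<in> region_I lam \<union> region_A lam \<longleftrightarrow> estep B (j - i + 1)"
    "(i, j) \<in> region_B lam \<union> region_I lam \<longleftrightarrow> \<not> estep B (j - i)"
    using 1 2 3 by auto
qed

section \<open>Rim-hooks and insertion paths\<close>

definition enc :: "(int \<Rightarrow> int \<Rightarrow> int) \<Rightarrow> cell \<Rightarrow> enat" where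
  "enc f u = (if u \<in> diagram lam then enat (nat (f (fst u) (content u)))
     else if fst u \<le> 0 \<or> snd u \<le> 0 then 0 else \<infinity>)"

lemma enc_rpps:
  assumes f: "rpp B f" shows "enc f \<in> rpps lam"
proof -
  have "enc f (i, j) \<le> enc f (i, j + 1) \<and> enc f (i, j) \<le> enc f (i + 1, j)"
    if "(i, j) \<in> diagram lam" for i j
  proof -
    have 1: "f i (j - i) \<le> f i (j + 1 - i)" if "(i, j + 1) \<in> diagram lam"
    proof -
      have "inD B i (j + 1 - i)" using that diagram_iff by blast
      moreover have "j + 1 - i - 1 = j - i" by simp
      ultimately show ?thesis using f unfolding rpp_def by metis
    qed
    have 2: "f i (j - i) \<le> f (i + 1) (j - (i + 1))" if "(i + 1, j) \<in> diagram lam"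
    proof -
      have "inD B (i + 1) (j - (i + 1))" using that diagram_iff by blast
      moreover have "j - (i + 1) + 1 = j - i" "i + 1 - 1 = i" by simp_all
      ultimately show ?thesis using f unfolding rpp_def by metis
    qed
    show ?thesis using 1 2 that unfolding enc_def content_def by (auto simp: in_diagram nat_mono)
  qed
  then have "enc f u \<le> enc f (ee u) \<and> enc f u \<le> enc f (ss u)" if "u \<in> diagram lam" for u
    using that unfolding ee_def ss_def by (cases u) simp
  then show ?thesis unfolding rpps_def by (simp add: enc_def)
qed

lemma enc_inject:
  assumes "rpp B f" "rpp B g" "enc f = enc g" shows "f = g"
proof (intro ext)
  fix r c
  show "f r c = g r c"
  proof (cases "inD B r c")
    case True
    then have "(r, r + c) \<in> diagram lam" using diagram_iff by auto
    then have "nat (f r c) = nat (g r c)" using fun_cong[OF assms(3), of "(r, r + c)"]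
      unfolding enc_def content_def by simp
    then show ?thesis using rpp_nonneg[OF assms(1), of r c] rpp_nonneg[OF assms(2), of r c] by simp
  qed (use assms in \<open>auto simp: rpp_def\<close>)
qed

lemma rpps_enc:
  assumes p: "p \<in> rpps lam" shows "\<exists>f. rpp B f \<and> enc f = p"
proof -
  define f where "f = (\<lambda>r c. if inD B r c then int (the_enat (p (r, r + c))) else 0)"
  have fin: "p u \<noteq> \<infinity>" if "u \<in> diagram lam" for u using p that unfolding rpps_def by blast
  have out: "p u = (if fst u \<le> 0 \<or> snd u \<le> 0 then 0 else \<infinity>)" if "u \<notin> diagram lam" for u
    using p that unfolding rpps_def by blast
  have mono: "p u \<le> p (ee u)" "p u \<le> p (ss u)" if "u \<in> diagram lam" for u
    using p that unfolding rpps_def by blast+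
  have D: "inD B r c \<longleftrightarrow> (r, r + c) \<in> diagram lam" for r c using diagram_iff[of r "r + c"] by simp
  have le: "the_enat (p u) \<le> the_enat (p v)" if "p u \<le> p v" "v \<in> diagram lam" for u v
    using that fin[OF that(2)] by (cases "p u"; cases "p v") auto
  have "f r (c - 1) \<le> f r c" if rc: "inD B r c" for r c
  proof (cases "inD B r (c - 1)")
    case True
    have "ee (r, r + (c - 1)) = (r, r + c)" unfolding ee_def by simp
    then show ?thesis using mono(1)[of "(r, r + (c - 1))"] le[of "(r, r + (c - 1))" "(r, r + c)"] True rc
      unfolding f_def by (simp add: D)
  qed (simp add: f_def)
  moreover have "f (r - 1) (c + 1) \<le> f r c" if rc: "inD B r c" for r c
  proof (cases "inD B (r - 1) (c + 1)")
    case True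
    have "ss (r - 1, r - 1 + (c + 1)) = (r, r + c)" unfolding ss_def by simp
    then show ?thesis using mono(2)[of "(r - 1, r - 1 + (c + 1))"]
        le[of "(r - 1, r - 1 + (c + 1))" "(r, r + c)"] True rc
      unfolding f_def by (simp add: D)
  qed (simp add: f_def)
  ultimately have "rpp B f" unfolding rpp_def by (auto simp: f_def)
  moreover have "enc f u = p u" for u
    using fin[of u] out[of u] unfolding enc_def f_def content_def by (cases u) (auto simp: D)
  ultimately show ?thesis by blast
qed

text \<open>The north-east path with \<open>n\<close> steps whose head has content \<open>c\<close>; the cell of content \<open>d\<close> lies in row \<open>\<rho> d\<close>.\<close>

definition path_list :: "(int \<Rightarrow> int) \<Rightarrow> int \<Rightarrow> nat \<Rightarrow> cell list" where
  "path_list \<rho> c n = map (\<lambda>k. (\<rho> (c + int k), \<rho> (c + int k) + (c + int k))) [0..<Suc n]"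

lemma length_path_list: "length (path_list \<rho> c n) = Suc n"
  and path_length_path_list: "path_length (path_list \<rho> c n) = n"
  and hd_path_list: "hd (path_list \<rho> c n) = (\<rho> c, \<rho> c + c)"
  and last_path_list: "last (path_list \<rho> c n) = (\<rho> (c + int n), \<rho> (c + int n) + (c + int n))"
  and nth_path_list: "k \<le> n \<Longrightarrow> path_list \<rho> c n ! k = (\<rho> (c + int k), \<rho> (c + int k) + (c + int k))"
  and set_path_list: "(i, j) \<in> set (path_list \<rho> c n) \<longleftrightarrow> c \<le> j - i \<and> j - i \<le> c + int n \<and> i = \<rho> (j - i)"
proof -
  show "length (path_list \<rho> c n) = Suc n" unfolding path_list_def by simp
  then show "path_length (path_list \<rho> c n) = n" unfolding path_length_def by simp
  show "hd (path_list \<rho> c n) = (\<rho> c, \<rho> c + c)" unfolding path_list_def by (simp add: hd_map del: upt_Suc)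
  show "last (path_list \<rho> c n) = (\<rho> (c + int n), \<rho> (c + int n) + (c + int n))" unfolding path_list_def by simp
  show "k \<le> n \<Longrightarrow> path_list \<rho> c n ! k = (\<rho> (c + int k), \<rho> (c + int k) + (c + int k))"
    unfolding path_list_def by (simp del: upt_Suc)
  show "(i, j) \<in> set (path_list \<rho> c n) \<longleftrightarrow> c \<le> j - i \<and> j - i \<le> c + int n \<and> i = \<rho> (j - i)"
  proof
    assume "(i, j) \<in> set (path_list \<rho> c n)"
    then show "c \<le> j - i \<and> j - i \<le> c + int n \<and> i = \<rho> (j - i)"
      unfolding path_list_def by (auto simp del: upt_Suc)
  next
    assume a: "c \<le> j - i \<and> j - i \<le> c + int n \<and> i = \<rho> (j - i)"
    define k where "k = nat (j - i - c)"
    have "c + int k = j - i" "k < Suc n" using a unfolding k_def by auto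
    moreover have "\<rho> (j - i) = i" using a by simp
    ultimately show "(i, j) \<in> set (path_list \<rho> c n)"
      unfolding path_list_def by (auto simp del: upt_Suc intro!: image_eqI[of _ _ k])
  qed
qed

lemma path_list_Suc: "path_list \<rho> c (Suc n) =
    path_list \<rho> c n @ [(\<rho> (c + int (Suc n)), \<rho> (c + int (Suc n)) + (c + int (Suc n)))]"
  unfolding path_list_def by simp

section \<open>Insertion paths as lists of cells\<close>

lemma ins_pathD:
  assumes "ins_path B f i ct ch \<rho>"
  shows "\<rho> ct = i" "ch \<le> ct" "\<And>c. ch \<le> c \<Longrightarrow> c \<le> ct \<Longrightarrow> inD B (\<rho> c) c"
    "\<And>c. ch < c \<Longrightarrow> c \<le> ct \<Longrightarrow>
        \<rho> (c - 1) = (if \<not> estep B c \<and> f (\<rho> c) c = f (\<rho> c + 1) (c - 1) then \<rho> c + 1 else \<rho> c)"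
    "\<And>c. ch < c \<Longrightarrow> c \<le> ct \<Longrightarrow> estep B c \<Longrightarrow> f (\<rho> c) (c - 1) = f (\<rho> c) c"
  using assms unfolding ins_path_def by blast+

lemma ne_path_path_list:
  assumes p: "ins_path B f i ct ch \<rho>"
  shows "ne_path lam (path_list \<rho> ch (nat (ct - ch)))"
proof -
  note \<rho> = ins_pathD[OF p]
  have "set (path_list \<rho> ch (nat (ct - ch))) \<subseteq> diagram lam"
  proof
    fix u assume u: "u \<in> set (path_list \<rho> ch (nat (ct - ch)))"
    obtain i j where ij: "u = (i, j)" by force
    then have "ch \<le> j - i" "j - i \<le> ct" and i: "i = \<rho> (j - i)" using u \<rho>(2) by (auto simp: set_path_list)
    then have "inD B i (j - i)" using \<rho>(3)[of "j - i"] by simp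
    then show "u \<in> diagram lam" using ij diagram_iff by auto
  qed
  moreover have "path_list \<rho> ch (nat (ct - ch)) ! Suc k = nn (path_list \<rho> ch (nat (ct - ch)) ! k) \<or>
      path_list \<rho> ch (nat (ct - ch)) ! Suc k = ee (path_list \<rho> ch (nat (ct - ch)) ! k)"
    if "Suc k < length (path_list \<rho> ch (nat (ct - ch)))" for k
  proof -
    have k: "Suc k \<le> nat (ct - ch)" using that by (simp add: length_path_list)
    let ?c = "ch + int (Suc k)"
    have "\<rho> (?c - 1) = \<rho> ?c + 1 \<or> \<rho> (?c - 1) = \<rho> ?c" using \<rho>(4)[of ?c] k by (auto split: if_splits)
    moreover have "?c - 1 = ch + int k" by simp
    ultimately show ?thesis using k by (auto simp: nth_path_list nn_def ee_def)
  qed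
  moreover have "path_list \<rho> ch (nat (ct - ch)) \<noteq> []" by (metis length_path_list list.size(3) nat.distinct(1))
  ultimately show ?thesis unfolding ne_path_def by blast
qed

text \<open>The bottom cell of a column has an east step at its content. Away from east steps, the
  comparison with the southern cell therefore avoids the values outside, which are 0 for
  \<open>f\<close> but may be infinite for \<open>enc f\<close>.\<close>

lemma south_in_diagram:
  assumes "inD B r c" "\<not> estep B c" shows "inD B (r + 1) (c - 1)"
proof -
  have "r \<noteq> conj_part lam (r + c)" using assms unfolding inD_def estep_def by force
  then show ?thesis using assms unfolding inD_def by auto
qed

lemma enc_eq_iff:
  assumes "rpp B f" "inD B r c" "inD B r' c'"
  shows "enc f (r, r + c) = enc f (r', r' + c') \<longleftrightarrow> f r c = f r' c'"
  using assms rpp_nonneg[OF assms(1), of r c] rpp_nonneg[OF assms(1), of r' c'] diagram_iff[of r "r + c"]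
    diagram_iff[of r' "r' + c'"]
  unfolding enc_def content_def by auto

lemma sw_walk_enc:
  assumes f: "rpp B f" and p: "ins_path B f i ct ch \<rho>" and n: "ch + int n \<le> ct"
  shows "sw_walk lam (enc f) n (\<rho> (ch + int n), \<rho> (ch + int n) + (ch + int n)) = rev (path_list \<rho> ch n)"
  using n
proof (induction n)
  case 0
  show ?case by (simp add: path_list_def)
next
  case (Suc n)
  note \<rho> = ins_pathD[OF p]
  let ?c = "ch + int (Suc n)"
  let ?u = "(\<rho> ?c, \<rho> ?c + ?c)"
  have D: "inD B (\<rho> ?c) ?c" using \<rho>(3) Suc.prems by auto
  then have uD: "?u \<in> diagram lam" using diagram_iff by auto
  have reg: "?u \<in> region_B lam \<union> region_I lam \<longleftrightarrow> \<not> estep B ?c" using regions(2)[OF uD] by simp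
  have "\<rho> (?c - 1) = (if \<not> estep B ?c \<and> f (\<rho> ?c) ?c = f (\<rho> ?c + 1) (?c - 1) then \<rho> ?c + 1 else \<rho> ?c)"
    using \<rho>(4)[of ?c] Suc.prems by auto
  moreover have "enc f ?u = enc f (ss ?u) \<longleftrightarrow> f (\<rho> ?c) ?c = f (\<rho> ?c + 1) (?c - 1)" if "\<not> estep B ?c"
    using enc_eq_iff[OF f D south_in_diagram[OF D that]] unfolding ss_def by (simp add: algebra_simps)
  ultimately have step: "(if ?u \<in> region_B lam \<union> region_I lam \<and> enc f ?u = enc f (ss ?u) then ss ?u else ww ?u)
      = (\<rho> (?c - 1), \<rho> (?c - 1) + (?c - 1))"
    using reg unfolding ss_def ww_def by (cases "estep B ?c") auto
  have c1: "?c - 1 = ch + int n" by simp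
  show ?case unfolding sw_walk.simps(2) step path_list_Suc c1 using Suc by simp
qed

lemma add_path_enc:
  assumes f: "rpp B f" and p: "ins_path B f i ct ch \<rho>" and P: "set P = set (path_list \<rho> ch (nat (ct - ch)))"
  shows "add_path (enc f) P = enc (bump f ch ct \<rho>)"
proof
  fix u :: cell
  obtain i j where u: "u = (i, j)" by force
  note \<rho> = ins_pathD[OF p]
  have mem: "u \<in> set P \<longleftrightarrow> ch \<le> j - i \<and> j - i \<le> ct \<and> i = \<rho> (j - i)"
    using \<rho>(2) unfolding P u set_path_list by auto
  have uD: "u \<in> diagram lam" if "u \<in> set P"
    using that P ne_path_path_list[OF p] unfolding ne_path_def by blast
  show "add_path (enc f) P u = enc (bump f ch ct \<rho>) u"
  proof (cases "u \<in> diagram lam")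
    case True
    have "0 \<le> f i (j - i)" using rpp_nonneg[OF f] .
    then show ?thesis using True mem unfolding add_path_def enc_def bump_def u content_def
      by (auto simp: nat_add_distrib one_enat_def)
  next
    case False
    then show ?thesis using uD unfolding add_path_def enc_def by auto
  qed
qed

text \<open>A cell of \<open>region_I\<close> or \<open>region_A\<close> has an east step at the
  next content, where the path arrives by going west across equal entries. The assumption on
  \<open>ct + 1\<close> keeps the tail out of these regions. South steps are taken only between
  equal entries.\<close>

lemma compatible_enc:
  assumes f: "rpp B f" and p: "ins_path B f i ct ch \<rho>" and tail: "\<not> estep B (ct + 1)"
  shows "compatible lam (path_list \<rho> ch (nat (ct - ch))) (enc f)"
proof -
  note \<rho> = ins_pathD[OF p]
  let ?P = "path_list \<rho> ch (nat (ct - ch))"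
  have mem: "(i, j) \<in> set ?P \<longleftrightarrow> ch \<le> j - i \<and> j - i \<le> ct \<and> i = \<rho> (j - i)" for i j
    using \<rho>(2) unfolding set_path_list by auto
  have PD: "set ?P \<subseteq> diagram lam" using ne_path_path_list[OF p] unfolding ne_path_def by blast
  have A: "ee (i, j) \<in> set ?P \<and> enc f (i, j) = enc f (ee (i, j))"
    if u: "(i, j) \<in> set ?P" "(i, j) \<in> region_I lam \<union> region_A lam" for i j
  proof -
    have D: "(i, j) \<in> diagram lam" using u PD by blast
    have e: "estep B (j - i + 1)" using regions(1)[OF D] u by blast
    then have c: "ch < j - i + 1" "j - i + 1 \<le> ct" using u(1) tail by (cases "j - i = ct"; auto simp: mem)+
    have i: "i = \<rho> (j - i)" using u(1) mem by blast
    have 1: "\<rho> (j - i + 1) = i" using \<rho>(4)[OF c] e i by simp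
    then have "ee (i, j) \<in> set ?P" using c unfolding ee_def by (simp add: mem algebra_simps)
    moreover then have "inD B i (j - i + 1)" using PD diagram_iff[of i "j + 1"] unfolding ee_def by (auto simp: algebra_simps)
    moreover have "f i (j - i) = f i (j - i + 1)" using \<rho>(5)[OF c e] 1 by simp
    ultimately show ?thesis using enc_eq_iff[OF f, of i "j - i" i "j - i + 1"] D diagram_iff[of i j]
      unfolding ee_def by (simp add: algebra_simps)
  qed
  have S: "enc f (i, j) = enc f (ss (i, j))" if u: "(i, j) \<in> set ?P" "ss (i, j) \<in> set ?P" for i j
  proof -
    have s: "ch \<le> j - (i + 1)" "i + 1 = \<rho> (j - (i + 1))" using u(2) unfolding ss_def by (simp_all add: mem)
    have c: "ch < j - i" "j - i \<le> ct" "i = \<rho> (j - i)" using s(1) u(1) mem[of i j] by auto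
    have "\<rho> (j - i - 1) = i + 1" using s(2) by (simp add: algebra_simps)
    then have "f i (j - i) = f (i + 1) (j - i - 1)" using \<rho>(4)[OF c(1,2)] c(3) by (auto split: if_splits)
    moreover have "inD B i (j - i)" "inD B (i + 1) (j - i - 1)"
      using u PD diagram_iff[of i j] diagram_iff[of "i + 1" j] unfolding ss_def by (auto simp: algebra_simps)
    ultimately show ?thesis using enc_eq_iff[OF f, of i "j - i" "i + 1" "j - i - 1"]
      unfolding ss_def by (simp add: algebra_simps)
  qed
  show ?thesis unfolding compatible_def using A S by (auto simp: split_paired_all)
qed

section \<open>Rim-hooks and their cells\<close>

definition hook_cell :: "cell list \<Rightarrow> cell" where
  "hook_cell g = (fst (last g), snd (hd g))"

lemma content_ne_path:
  assumes "ne_path lam P" "k < length P"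
  shows "content (P ! k) = content (hd P) + int k"
  using assms(2)
proof (induction k)
  case 0
  then show ?case by (simp add: hd_conv_nth)
next
  case (Suc k)
  then have "P ! Suc k = nn (P ! k) \<or> P ! Suc k = ee (P ! k)" using assms(1) unfolding ne_path_def by blast
  then show ?case using Suc unfolding content_def nn_def ee_def by auto
qed

lemma row_ne_path:
  assumes "ne_path lam P" "k < length P"
  shows "fst (P ! k) \<le> fst (hd P) \<and> snd (hd P) \<le> snd (P ! k)"
  using assms(2)
proof (induction k)
  case 0
  then show ?case by (simp add: hd_conv_nth)
next
  case (Suc k)
  then have "P ! Suc k = nn (P ! k) \<or> P ! Suc k = ee (P ! k)" using assms(1) unfolding ne_path_def by blast
  then show ?case using Suc unfolding nn_def ee_def by auto
qed

lemma rim_hook_ends: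
  assumes g: "rim_hook lam g"
  shows "hd g = (conj_part lam (snd (hd g)), snd (hd g))" "hook_cell g \<in> diagram lam"
    "last g \<in> diagram lam" "int (path_length g) = content (last g) - content (hd g)"
    "ee (last g) \<notin> diagram lam"
proof -
  have ne: "ne_path lam g" "g \<noteq> []" "set g \<subseteq> diagram lam" using g unfolding rim_hook_def ne_path_def by auto
  have h: "hd g \<in> diagram lam" "last g \<in> diagram lam" using ne by auto
  show "last g \<in> diagram lam" by fact
  show "ee (last g) \<notin> diagram lam" using g unfolding rim_hook_def by blast
  have "ss (hd g) \<notin> diagram lam" using g unfolding rim_hook_def by blast
  then show "hd g = (conj_part lam (snd (hd g)), snd (hd g))"
    using h(1) unfolding ss_def by (cases "hd g") (auto simp: in_diagram)
  have l: "last g = g ! (length g - 1)" "length g - 1 < length g" using ne by (auto simp: last_conv_nth)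
  show "int (path_length g) = content (last g) - content (hd g)"
    using content_ne_path[OF ne(1) l(2)] l(1) unfolding path_length_def by simp
  have "fst (last g) \<le> fst (hd g)" using row_ne_path[OF ne(1) l(2)] l(1) by simp
  then show "hook_cell g \<in> diagram lam" using h
    by (cases "hd g"; cases "last g") (auto simp: hook_cell_def in_diagram)
qed

lemma last_in_row:
  assumes "(i, j) \<in> diagram lam" "(i, j + 1) \<notin> diagram lam" shows "j = part lam i"
  using assms unfolding diagram_def by auto

text \<open>A diagonal of the shape has no gaps, so only its last cell lacks a south-eastern
  neighbour.\<close>

lemma rim_cell_unique:
  assumes "inD B r c" "\<not> inD B (r + 1) c" "inD B r' c" "\<not> inD B (r' + 1) c"
  shows "r = r'"
proof -
  have "inD B (k + 1) c" if "1 \<le> k" "k < l" "inD B l c" "1 \<le> k + c" for k l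
    using that h_anti[of "k + 1 + c" "l + c"] unfolding inD_def by auto
  then show ?thesis using assms unfolding inD_def by (metis linorder_neqE)
qed

text \<open>The cell fixes head and tail and hence the length. At each content in between, a
  rim-hook must use the only rim cell of that diagonal.\<close>

lemma hook_cell_inject:
  assumes g: "rim_hook lam g" and g': "rim_hook lam g'" and eq: "hook_cell g = hook_cell g'"
  shows "g = g'"
proof -
  have ne: "ne_path lam g" "g \<noteq> []" "set g \<subseteq> diagram lam"
    and ne': "ne_path lam g'" "g' \<noteq> []" "set g' \<subseteq> diagram lam"
    using g g' unfolding rim_hook_def ne_path_def by auto
  have hd: "hd g = hd g'" using rim_hook_ends(1)[OF g] rim_hook_ends(1)[OF g'] eq unfolding hook_cell_def by simp
  have l: "fst (last g) = fst (last g')" using eq unfolding hook_cell_def by simp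
  have "snd (last g) = part lam (fst (last g))" "snd (last g') = part lam (fst (last g'))"
    using rim_hook_ends(3,5)[OF g] rim_hook_ends(3,5)[OF g'] last_in_row unfolding ee_def by auto
  then have last: "last g = last g'" using l by (simp add: prod_eq_iff)
  have "path_length g = path_length g'" using rim_hook_ends(4)[OF g] rim_hook_ends(4)[OF g'] hd last by simp
  then have len: "length g = length g'" using ne ne' unfolding path_length_def
    by (metis One_nat_def Suc_pred length_greater_0_conv)
  show ?thesis
  proof (rule nth_equalityI[OF len])
    fix k assume k: "k < length g"
    have c: "content (g ! k) = content (g' ! k)"
      using content_ne_path[OF ne(1) k] content_ne_path[OF ne'(1), of k] k len hd by simp
    have m: "g ! k \<in> set g" "g' ! k \<in> set g'" using k len by auto
    have "ee (ss (g ! k)) \<notin> diagram lam" "ee (ss (g' ! k)) \<notin> diagram lam"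
      using g g' m unfolding rim_hook_def by blast+
    moreover have "g ! k \<in> diagram lam" "g' ! k \<in> diagram lam" using m ne ne' by auto
    ultimately show "g ! k = g' ! k"
      using rim_cell_unique[of "fst (g ! k)" "content (g ! k)" "fst (g' ! k)"] c
      unfolding content_def ee_def ss_def
      by (cases "g ! k"; cases "g' ! k") (auto simp: diagram_iff)
  qed
qed

lemma fills_zero: "fills b (\<lambda>i j. 0) (\<lambda>r c. 0)"
proof (induction b)
  case (Suc b)
  have "column_step b (\<lambda>r c. 0) (\<lambda>r. 0) (\<lambda>r c. 0)" unfolding column_step_def rpp_def by simp
  then show ?case using Suc by auto
qed simp

lemma row_end:
  assumes "(i, j) \<in> diagram lam"
  shows "inD B i (part lam i - i)" "\<not> inD B i (part lam i - i + 1)"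
proof -
  have "(i, part lam i) \<in> diagram lam" "(i, part lam i + 1) \<notin> diagram lam"
    using assms unfolding diagram_def by auto
  then show "inD B i (part lam i - i)" "\<not> inD B i (part lam i - i + 1)"
    by (simp_all add: diagram_iff algebra_simps)
qed

text \<open>The right edge of row \<open>i\<close>, a north step, enters the boundary vertex of
  content \<open>c + 1\<close>.\<close>

lemma not_estep_row_end:
  assumes "inD B i c" "\<not> inD B i (c + 1)"
  shows "\<not> estep B (c + 1)"
proof -
  have "int B < i + c + 1 \<or> conj_part lam (i + c + 1) < i" using assms unfolding inD_def by (auto simp: algebra_simps)
  then show ?thesis using estep_between[of "i + c" "c + 1"] assms(1) unfolding inD_def by auto
qed

text \<open>The rim-hook of a cell is its insertion path into the zero reverse plane partition.\<close>

lemma rim_hook_exists: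
  assumes u: "(i, j) \<in> diagram lam"
  shows "\<exists>g. rim_hook lam g \<and> hook_cell g = (i, j)"
proof -
  define ct where "ct = part lam i - i"
  define ch where "ch = j - conj_part lam j"
  have D: "inD B i (j - i)" using u diagram_iff by blast
  have j: "1 \<le> j" "j \<le> int B" using D unfolding inD_def by auto
  note e = row_end[OF u, folded ct_def]
  obtain \<rho> where p: "ins_path B (\<lambda>r c. 0) i ct ch \<rho>"
    using fills_insert[OF fills_zero D e] unfolding ch_def by blast
  note \<rho> = ins_pathD[OF p]
  \<comment> \<open>All entries are 0, so the path goes south wherever the boundary has no east
    step, and never leaves the rim.\<close>
  have rim: "\<not> inD B (\<rho> c + 1) c" if "ch \<le> c" "c \<le> ct" for c
    using that(2,1)
  proof (induction c rule: int_le_induct)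
    case base
    show ?case using e(2) inD_up[of B "i + 1" ct] \<rho>(1) D unfolding inD_def by auto
  next
    case (step c)
    have c: "ch < c" "ch \<le> c" using step by auto
    have IH: "\<not> inD B (\<rho> c + 1) c" using step.IH c by blast
    have rc: "inD B (\<rho> c) c" using \<rho>(3) c step by blast
    show ?case
    proof (cases "estep B c")
      case True
      then have eq: "\<rho> (c - 1) = \<rho> c" using \<rho>(4)[OF c(1)] step by auto
      show ?thesis
      proof
        assume a: "inD B (\<rho> (c - 1) + 1) (c - 1)"
        \<comment> \<open>A rim cell with an east step at its content is the bottom of its column,
          so nothing lies below it.\<close>
        have "int B < \<rho> c + c + 1 \<or> conj_part lam (\<rho> c + c + 1) \<le> \<rho> c"
          using IH rc unfolding inD_def by (auto simp: algebra_simps)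
        then show False using estep_between[of "\<rho> c + c" c] a eq True rc unfolding inD_def by auto
      qed
    next
      case False
      then have eq: "\<rho> (c - 1) = \<rho> c + 1" using \<rho>(4)[OF c(1)] step by auto
      show ?thesis
      proof
        assume "inD B (\<rho> (c - 1) + 1) (c - 1)"
        then have "inD B (\<rho> c + 1) c" using inD_up[of B "\<rho> c + 2" "c - 1"] eq rc
          by (auto simp: inD_def algebra_simps)
        then show False using IH by blast
      qed
    qed
  qed
  have "inD B (conj_part lam j) ch" "\<not> inD B (conj_part lam j + 1) ch"
    using j conj_part_pos[of j] h_anti[of j "j + 1"] unfolding inD_def ch_def by (auto simp: algebra_simps)
  then have head: "\<rho> ch = conj_part lam j"
    using rim_cell_unique \<rho>(2) \<rho>(3)[of ch] rim[of ch] by blast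
  define g where "g = path_list \<rho> ch (nat (ct - ch))"
  have ends: "hd g = (conj_part lam j, j)" "last g = (i, part lam i)"
    unfolding g_def hd_path_list last_path_list using \<rho>(1,2) head by (simp_all add: ch_def ct_def)
  have "ee (ss v) \<notin> diagram lam" if v: "v \<in> set g" for v
  proof -
    obtain a b where ab: "v = (a, b)" by force
    have "ch \<le> b - a" "b - a \<le> ct" "a = \<rho> (b - a)" using v \<rho>(2) unfolding ab g_def set_path_list by auto
    then have "\<not> inD B (a + 1) (b - a)" using rim by metis
    then show ?thesis unfolding ab ee_def ss_def by (simp add: diagram_iff)
  qed
  moreover have "ss (hd g) \<notin> diagram lam" unfolding ends ss_def by (simp add: in_diagram)
  moreover have "ee (last g) \<notin> diagram lam" unfolding ends ee_def diagram_def by simp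
  ultimately have "rim_hook lam g" using ne_path_path_list[OF p] unfolding rim_hook_def g_def by blast
  then show ?thesis using ends unfolding hook_cell_def by force
qed

lemma last_rim_hook: "rim_hook lam g \<Longrightarrow> last g = (fst (hook_cell g), part lam (fst (hook_cell g)))"
  using rim_hook_ends(3,5) last_in_row unfolding ee_def hook_cell_def by (simp add: prod_eq_iff)

lemma hd_rim_hook: "rim_hook lam g \<Longrightarrow> hd g = (conj_part lam (snd (hook_cell g)), snd (hook_cell g))"
  using rim_hook_ends(1) unfolding hook_cell_def by simp

lemma hook_at_iff: "hook_at lam u g \<longleftrightarrow> rim_hook lam g \<and> hook_cell g = u"
proof
  assume "hook_at lam u g"
  then show "rim_hook lam g \<and> hook_cell g = u" unfolding hook_at_def hook_cell_def by (simp add: prod_eq_iff)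
next
  assume "rim_hook lam g \<and> hook_cell g = u"
  then show "hook_at lam u g" using rim_hook_ends(2) last_rim_hook hd_rim_hook unfolding hook_at_def by metis
qed

lemma hook_le_iff:
  "rim_hook lam g \<Longrightarrow> rim_hook lam g' \<Longrightarrow> hook_le lam g g' \<longleftrightarrow> cell_le (hook_cell g) (hook_cell g')"
  unfolding hook_le_def hook_at_iff by auto

section \<open>Inserting sorted sequences of rim-hooks\<close>

text \<open>The path of \<open>fills_insert\<close> serves twice: its reverse is the south-west
  walk, and the path itself witnesses \<open>inserts\<close>.\<close>

lemma insert_hook:
  assumes f: "fills B m f" and g: "rim_hook lam g" and cell: "hook_cell g = (i, j)"
    and m: "\<And>i' j'. j < j' \<or> j' = j \<and> i < i' \<Longrightarrow> m i' j' = 0"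
  shows "\<exists>f'. fills B (\<lambda>i' j'. m i' j' + (if i' = i \<and> j' = j then 1 else 0)) f' \<and>
     hook_insert lam g (enc f) = enc f' \<and> inserts lam g (enc f)"
proof -
  have u: "(i, j) \<in> diagram lam" using rim_hook_ends(2)[OF g] cell by simp
  define ct where "ct = part lam i - i"
  define ch where "ch = j - conj_part lam j"
  have D: "inD B i (j - i)" using u diagram_iff by blast
  note e = row_end[OF u, folded ct_def]
  obtain \<rho> where p: "ins_path B f i ct ch \<rho>"
    and f': "fills B (\<lambda>i' j'. m i' j' + (if i' = i \<and> j' = j then 1 else 0)) (bump f ch ct \<rho>)"
    using fills_insert[OF f D e m] unfolding ch_def by blast
  note \<rho> = ins_pathD[OF p]
  note rf = fills_rpp[OF f] and rf' = fills_rpp[OF f']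
  define n where "n = nat (ct - ch)"
  let ?P = "path_list \<rho> ch n"
  have len: "path_length g = n"
    using rim_hook_ends(4)[OF g] last_rim_hook[OF g] hd_rim_hook[OF g] cell
    unfolding content_def n_def ct_def ch_def by simp
  have last: "last g = (\<rho> (ch + int n), \<rho> (ch + int n) + (ch + int n))"
    using last_rim_hook[OF g] cell \<rho>(1,2) unfolding n_def ct_def by simp
  have "insertion_path lam g (enc f) = rev ?P"
    unfolding insertion_path_def len last by (rule sw_walk_enc[OF rf p]) (use \<rho>(2) in \<open>auto simp: n_def\<close>)
  then have "hook_insert lam g (enc f) = enc (bump f ch ct \<rho>)"
    unfolding hook_insert_def using add_path_enc[OF rf p, of "rev ?P"] n_def by simp
  moreover have "inserts lam g (enc f)"
    unfolding inserts_def
  proof (intro exI[of _ ?P] conjI)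
    show "ne_path lam ?P" using ne_path_path_list[OF p] n_def by simp
    show "last ?P = last g" using last last_path_list by simp
    show "path_length ?P = path_length g" using len path_length_path_list by simp
    show "compatible lam ?P (enc f)" using compatible_enc[OF rf p not_estep_row_end[OF e]] n_def by simp
    show "add_path (enc f) ?P \<in> rpps lam"
      using add_path_enc[OF rf p, of ?P] enc_rpps[OF rf'] n_def by simp
  qed
  ultimately show ?thesis using f' by blast
qed

definition mult :: "cell list multiset \<Rightarrow> int \<Rightarrow> int \<Rightarrow> nat" where
  "mult M i j = count (image_mset hook_cell M) (i, j)"

text \<open>Reading from right to left, each new hook is at most all hooks already inserted, so
  their cells are neither further right nor lower in its own column. This is the condition under
  which \<open>insert_hook\<close> raises one multiplicity by one.\<close>

lemma insert_sorted_hooks: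
  assumes "\<forall>g\<in>set hs. rim_hook lam g" "sorted_wrt (hook_le lam) hs"
  shows "\<exists>f. fills B (mult (mset hs)) f \<and> insert_all lam hs = enc f \<and>
     (\<forall>k < length hs. inserts lam (hs ! k) (insert_all lam (drop (Suc k) hs)))"
  using assms
proof (induction hs)
  case Nil
  have "zero_rpp lam = enc (\<lambda>r c. 0)" unfolding zero_rpp_def enc_def by (auto simp: zero_enat_def)
  moreover have "mult {#} = (\<lambda>i j. 0)" unfolding mult_def by auto
  ultimately show ?case using fills_zero[of B] by (auto simp: insert_all_def)
next
  case (Cons g hs)
  then obtain f where f: "fills B (mult (mset hs)) f" "insert_all lam hs = enc f"
     "\<forall>k < length hs. inserts lam (hs ! k) (insert_all lam (drop (Suc k) hs))" by auto
  obtain i j where c: "hook_cell g = (i, j)" by force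
  have g: "rim_hook lam g" using Cons by auto
  have z: "mult (mset hs) i' j' = 0" if "j < j' \<or> j' = j \<and> i < i'" for i' j'
  proof -
    have "(i', j') \<notin> hook_cell ` set hs"
    proof
      assume "(i', j') \<in> hook_cell ` set hs"
      then obtain g' where g': "g' \<in> set hs" "hook_cell g' = (i', j')" by auto
      then have "cell_le (i, j) (i', j')" using Cons.prems g c hook_le_iff[OF g, of g'] by auto
      then show False using that unfolding cell_le_def by auto
    qed
    then show ?thesis unfolding mult_def by (simp add: count_eq_zero_iff)
  qed
  obtain f' where f': "fills B (\<lambda>i' j'. mult (mset hs) i' j' + (if i' = i \<and> j' = j then 1 else 0)) f'"
     "hook_insert lam g (enc f) = enc f'" "inserts lam g (enc f)"
    using insert_hook[OF f(1) g c z] by blast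
  have "(\<lambda>i' j'. mult (mset hs) i' j' + (if i' = i \<and> j' = j then 1 else 0)) = mult (mset (g # hs))"
    unfolding mult_def using c by (auto simp: fun_eq_iff)
  moreover have "insert_all lam (g # hs) = enc f'" using f' f(2) unfolding insert_all_def by simp
  moreover have "inserts lam ((g # hs) ! k) (insert_all lam (drop (Suc k) (g # hs)))" if "k < length (g # hs)" for k
    using that f' f by (cases k) auto
  ultimately show ?case using f' by auto
qed

lemma hook_factorization_iff:
  "hook_factorization lam p hs \<longleftrightarrow>
     (\<forall>g\<in>set hs. rim_hook lam g) \<and> sorted_wrt (hook_le lam) hs \<and> p = insert_all lam hs"
  unfolding hook_factorization_def using insert_sorted_hooks by blast

section \<open>Sorting rim-hooks and counting them by cell\<close>

text \<open>The factor \<open>int (length lam) + 1\<close> exceeds every row index, so columns are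
  compared first; the sign reverses both comparisons. An integer key makes \<open>sort_key\<close>
  and the uniqueness of sorted lists available.\<close>

definition hook_key :: "cell list \<Rightarrow> int" where
  "hook_key g = - (snd (hook_cell g) * (int (length lam) + 1) + fst (hook_cell g))"

lemma cell_le_key:
  assumes u: "(a, b) \<in> diagram lam" and v: "(c, d) \<in> diagram lam"
  shows "cell_le (a, b) (c, d) \<longleftrightarrow> d * (int (length lam) + 1) + c \<le> b * (int (length lam) + 1) + a"
proof -
  let ?N = "int (length lam) + 1"
  have r: "1 \<le> a" "a < ?N" "1 \<le> c" "c < ?N" using u v unfolding diagram_def by auto
  have "d * ?N + ?N \<le> b * ?N" if "d < b" using mult_right_mono[of "d + 1" b ?N] that by (simp add: algebra_simps)
  moreover have "b * ?N + ?N \<le> d * ?N" if "b < d" using mult_right_mono[of "b + 1" d ?N] that by (simp add: algebra_simps)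
  ultimately show ?thesis using r unfolding cell_le_def by (cases b d rule: linorder_cases) auto
qed

lemma hook_le_key:
  assumes "rim_hook lam g" "rim_hook lam g'"
  shows "hook_le lam g g' \<longleftrightarrow> hook_key g \<le> hook_key g'"
  using hook_le_iff[OF assms] rim_hook_ends(2)[OF assms(1)] rim_hook_ends(2)[OF assms(2)]
    cell_le_key[of "fst (hook_cell g)" "snd (hook_cell g)" "fst (hook_cell g')" "snd (hook_cell g')"]
  unfolding hook_key_def prod.collapse by linarith

lemma inj_on_hook_key: "inj_on hook_key {g. rim_hook lam g}"
proof (rule inj_onI)
  fix g g' assume g: "g \<in> {g. rim_hook lam g}" "g' \<in> {g. rim_hook lam g}" and "hook_key g = hook_key g'"
  then have "cell_le (hook_cell g) (hook_cell g')" "cell_le (hook_cell g') (hook_cell g)"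
    using hook_le_key[of g g'] hook_le_key[of g' g] hook_le_iff[of g g'] hook_le_iff[of g' g] by auto
  then have "hook_cell g = hook_cell g'" unfolding cell_le_def by (auto simp: prod_eq_iff)
  then show "g = g'" using hook_cell_inject g by blast
qed

lemma sorted_hooks_iff:
  assumes "\<forall>g\<in>set hs. rim_hook lam g"
  shows "sorted_wrt (hook_le lam) hs \<longleftrightarrow> sorted (map hook_key hs)"
  unfolding sorted_map by (rule iffI; erule sorted_wrt_mono_rel[rotated]) (use assms hook_le_key in auto)

lemma sorted_hooks_unique:
  assumes "\<forall>g\<in>set hs. rim_hook lam g" "sorted_wrt (hook_le lam) hs" "sorted_wrt (hook_le lam) hs'"
    and eq: "mset hs = mset hs'"
  shows "hs = hs'"
proof -
  have r: "\<forall>g\<in>set hs'. rim_hook lam g" using assms(1) eq by (metis set_mset_mset)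
  have "sorted (map hook_key hs)" "sorted (map hook_key hs')"
    using assms sorted_hooks_iff r by blast+
  moreover have "mset (map hook_key hs) = mset (map hook_key hs')" using eq by simp
  ultimately have "map hook_key hs = map hook_key hs'" by (metis properties_for_sort)
  then show ?thesis by (rule map_inj_on) (use inj_on_hook_key assms(1) r in \<open>auto intro: inj_on_subset\<close>)
qed

lemma sorted_hooks_exist:
  assumes "\<forall>g\<in>#M. rim_hook lam g"
  shows "\<exists>hs. mset hs = M \<and> (\<forall>g\<in>set hs. rim_hook lam g) \<and> sorted_wrt (hook_le lam) hs"
proof -
  obtain xs where xs: "mset xs = M" using ex_mset by blast
  define hs where "hs = sort_key hook_key xs"
  have "mset hs = M" using xs unfolding hs_def by simp
  moreover have "\<forall>g\<in>set hs. rim_hook lam g" using assms calculation by auto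
  moreover have "sorted (map hook_key hs)" unfolding hs_def by (rule sorted_sort_key)
  ultimately show ?thesis using sorted_hooks_iff by blast
qed

definition hook_of :: "cell \<Rightarrow> cell list" where
  "hook_of u = (SOME g. rim_hook lam g \<and> hook_cell g = u)"

lemma hook_of: "u \<in> diagram lam \<Longrightarrow> rim_hook lam (hook_of u) \<and> hook_cell (hook_of u) = u"
  unfolding hook_of_def by (rule someI_ex) (cases u, use rim_hook_exists in auto)

lemma hook_of_cell: "rim_hook lam g \<Longrightarrow> hook_of (hook_cell g) = g"
  using hook_of[of "hook_cell g"] rim_hook_ends(2) hook_cell_inject by blast

text \<open>Mapping \<open>hook_of\<close> over the multiset of cells recovers the multiset of
  hooks.\<close>

lemma mult_inject:
  assumes M: "\<forall>g\<in>#M. rim_hook lam g" "\<forall>g\<in>#M'. rim_hook lam g"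
    and eq: "\<And>i j. (i, j) \<in> diagram lam \<Longrightarrow> mult M i j = mult M' i j"
  shows "M = M'"
proof -
  have "count (image_mset hook_cell M) u = count (image_mset hook_cell M') u" for u
  proof (cases "u \<in> diagram lam")
    case True
    then show ?thesis using eq[of "fst u" "snd u"] unfolding mult_def by simp
  next
    case False
    then have "u \<notin># image_mset hook_cell M" "u \<notin># image_mset hook_cell M'" using M rim_hook_ends(2) by auto
    then show ?thesis by (metis not_in_iff)
  qed
  then have "image_mset hook_cell M = image_mset hook_cell M'" by (simp add: multiset_eq_iff)
  then have "image_mset hook_of (image_mset hook_cell M) = image_mset hook_of (image_mset hook_cell M')" by simp
  moreover have "image_mset hook_of (image_mset hook_cell N) = N" if "\<forall>g\<in>#N. rim_hook lam g" for N
    using that hook_of_cell by (simp add: multiset.map_comp comp_def cong: image_mset_cong)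
  ultimately show ?thesis using M by simp
qed

lemma finite_diagram: "finite (diagram lam)"
proof (rule finite_subset)
  show "diagram lam \<subseteq> {1..int (length lam)} \<times> {1..int B}"
  proof
    fix u assume "u \<in> diagram lam"
    then show "u \<in> {1..int (length lam)} \<times> {1..int B}"
      using in_diagram[of "fst u" "snd u"] by (cases u) (simp add: diagram_def)
  qed
qed simp

lemma mult_exists: "\<exists>M. (\<forall>g\<in>#M. rim_hook lam g) \<and> (\<forall>(i, j)\<in>diagram lam. mult M i j = m i j)"
proof -
  define C where "C = (\<Sum>u\<in>diagram lam. replicate_mset (m (fst u) (snd u)) u)"
  have C: "count C u = (if u \<in> diagram lam then m (fst u) (snd u) else 0)" for u
    unfolding C_def using finite_diagram by (simp add: count_sum if_distrib sum.delta' cong: if_cong)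
  then have CD: "u \<in> diagram lam" if "u \<in># C" for u using that by (metis count_eq_zero_iff)
  define M where "M = image_mset hook_of C"
  have "image_mset hook_cell M = C" unfolding M_def using hook_of CD
    by (simp add: multiset.map_comp comp_def cong: image_mset_cong)
  moreover have "\<forall>g\<in>#M. rim_hook lam g" unfolding M_def using hook_of CD by auto
  ultimately show ?thesis using C unfolding mult_def by (intro exI[of _ M]) auto
qed

section \<open>Existence and uniqueness of the factorization\<close>

text \<open>Since \<open>enc\<close> is injective and a filling can be read off from its array, both
  sequences have the same multiplicity at every cell. They are then sorted lists of the same
  multiset.\<close>

lemma factorization_unique:
  assumes "hook_factorization lam p hs" "hook_factorization lam p hs'"
  shows "hs = hs'"
proof -
  note a = assms[unfolded hook_factorization_iff]
  obtain f where f: "fills B (mult (mset hs)) f" "p = enc f" using insert_sorted_hooks a(1) by metis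
  obtain f' where f': "fills B (mult (mset hs')) f'" "p = enc f'" using insert_sorted_hooks a(2) by metis
  have "f = f'" using enc_inject fills_rpp f f' by metis
  then have "mult (mset hs) i j = mult (mset hs') i j" if "(i, j) \<in> diagram lam" for i j
    using fills_inject[OF f(1), of "mult (mset hs')" i j] f'(1) that unfolding in_diagram by auto
  then have "mset hs = mset hs'" using mult_inject a by (metis set_mset_mset)
  then show ?thesis using sorted_hooks_unique a by blast
qed

text \<open>A filling of \<open>p\<close> prescribes a multiset of hooks. Inserting these in sorted
  order gives an array with the same filling, which is \<open>p\<close>.\<close>

lemma factorization_exists:
  assumes "p \<in> rpps lam"
  shows "\<exists>hs. hook_factorization lam p hs"
proof -
  obtain f where f: "rpp B f" "enc f = p" using rpps_enc assms by blast
  then obtain m where m: "fills B m f" using rpp_fills by blast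
  obtain M where M: "\<forall>g\<in>#M. rim_hook lam g" "\<And>i j. (i, j) \<in> diagram lam \<Longrightarrow> mult M i j = m i j"
    using mult_exists[of m] by blast
  obtain hs where hs: "mset hs = M" "\<forall>g\<in>set hs. rim_hook lam g" "sorted_wrt (hook_le lam) hs"
    using sorted_hooks_exist M by blast
  obtain f' where f': "fills B (mult M) f'" "insert_all lam hs = enc f'" using insert_sorted_hooks hs by metis
  have "f' = f" by (rule fills_unique[OF f'(1) m]) (use M in \<open>auto simp: in_diagram\<close>)
  then show ?thesis using hs f f' unfolding hook_factorization_iff by auto
qed

lemma insert_all_rpps:
  assumes "\<forall>g\<in>set hs. rim_hook lam g" "sorted_wrt (hook_le lam) hs"
  shows "insert_all lam hs \<in> rpps lam"
  using insert_sorted_hooks[OF assms] fills_rpp enc_rpps by metis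

end

theorem mainTheorem1:
  fixes lam :: "nat list"
  assumes "is_partition lam"
  shows "(\<forall>p\<in>rpps lam. \<exists>!hs. hook_factorization lam p hs) \<and>
    bij_betw (\<lambda>p. mset (THE hs. hook_factorization lam p hs))
      (rpps lam) {M. \<forall>h\<in>#M. rim_hook lam h}"
proof -
  interpret partition_shape lam using assms by unfold_locales
  have ex1: "\<exists>!hs. hook_factorization lam p hs" if "p \<in> rpps lam" for p
    using factorization_exists[OF that] factorization_unique by blast
  define F where "F = (\<lambda>p. THE hs. hook_factorization lam p hs)"
  have F: "hook_factorization lam p (F p)" if "p \<in> rpps lam" for p
    unfolding F_def by (rule theI'[OF ex1[OF that]])
  have F_eq: "F p = hs" if "hook_factorization lam p hs" for p hs
    unfolding F_def using factorization_unique that by (intro the_equality) auto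
  have "bij_betw (\<lambda>p. mset (F p)) (rpps lam) {M. \<forall>h\<in>#M. rim_hook lam h}"
    unfolding bij_betw_def
  proof (intro conjI inj_onI equalityI subsetI)
    fix p q assume pq: "p \<in> rpps lam" "q \<in> rpps lam" "mset (F p) = mset (F q)"
    \<comment> \<open>A sorted list of rim-hooks is determined by its multiset, and insertion then
      recovers the reverse plane partition.\<close>
    have "F p = F q" using sorted_hooks_unique F[OF pq(1)] F[OF pq(2)] pq(3) unfolding hook_factorization_iff by blast
    then show "p = q" using F[OF pq(1)] F[OF pq(2)] unfolding hook_factorization_iff by simp
  next
    fix M assume "M \<in> (\<lambda>p. mset (F p)) ` rpps lam"
    then show "M \<in> {M. \<forall>h\<in>#M. rim_hook lam h}" using F unfolding hook_factorization_iff by auto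
  next
    fix M assume "M \<in> {M. \<forall>h\<in>#M. rim_hook lam h}"
    then obtain hs where hs: "mset hs = M" "\<forall>g\<in>set hs. rim_hook lam g" "sorted_wrt (hook_le lam) hs"
      using sorted_hooks_exist by blast
    then have "insert_all lam hs \<in> rpps lam" "F (insert_all lam hs) = hs"
      using insert_all_rpps F_eq hook_factorization_iff by blast+
    then show "M \<in> (\<lambda>p. mset (F p)) ` rpps lam" using hs(1) by force
  qed
  then show ?thesis using ex1 unfolding F_def by blast
qed

end
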